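(* Let $F:\mathbb{R}^n\to\mathbb{R}$ be an a.s. smooth centred isotropic Gaussian random field, normalized so that $\mathbb{E}[F(x)^2]=1$, whose spectral measure $\rho$ satisfies: $(\rho1)$ $\rho$ has no atoms; $(\rho2)$ $\int_{\mathbb{R}^n}|\lambda|^p\,d\rho(\lambda)<\infty$ for some $p>4$; $(\rho3)$ the support of $\rho$ does not lie in a linear hyperplane; $(\rho4^* )$ the support of $\rho$ has non-empty interior. Then $\Psi_\rho(0)=0$, and $\Psi_\rho(\cdot)$ is strictly increasing on $[0,\infty)$; in particular $\Psi_\rho(t)>0$ for every $t>0$.
   Context: Isotropic means the covariance $\mathbb{E}[F(x)F(y)]$ depends only on $|x-y|$. The spectral measure $\rho$ is the probability measure on $\mathbb{R}^n$ whose Fourier transform is the covariance function of $F$. $B(R)$ is the ball of radius $R$ in $\mathbb{R}^n$ centred at the origin. A nodal domain of $F$ is a connected component of $\mathbb{R}^n\setminus F^{-1}(0)$. $\mathcal{N}(F,t;R)$ is the number of nodal domains $\omega$ of $F$ lying entirely in $B(R)$ with $n$-dimensional volume $\mathrm{Vol}(\omega)\le t$, and $\mathcal{N}(F;R)=\mathcal{N}(F,\infty;R)$. The Nazarov–Sodin constant is $c(\rho)=\lim_{R\to\infty}\mathcal{N}(F;R)/\mathrm{Vol}(B(R))$ (the limit exists in mean and a.s. under $(\rho1)$–$(\rho3)$, and is positive under $(\rho4^* )$). The function $\Psi_\rho$ is $\Psi_\rho(t)=\lim_{R\to\infty}\frac{\mathcal{N}(F,t;R)}{c(\rho)\,\mathrm{Vol}(B(R))}$,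 a deterministic limit in mean (which exists for every $t$). *)

theory Defs
  imports "HOL-Probability.Probability"
begin

section \<open>Gaussian random fields\<close>

text \<open>
  A random field is a function \<open>F w x\<close> of the sample point \<open>w\<close> and of the position \<open>x\<close>.
  The constant variable 0 counts as a (degenerate) centred Gaussian variable, as it has to:
  linear combinations of values of a Gaussian field may vanish.
\<close>

definition centred_gaussian_rv :: "'w measure \<Rightarrow> ('w \<Rightarrow> real) \<Rightarrow> bool" where
  "centred_gaussian_rv M Y \<longleftrightarrow> Y \<in> borel_measurable M \<and>
     ((\<exists>\<sigma>>0. distributed M lborel Y (\<lambda>x. ennreal (normal_density 0 \<sigma> x))) \<or> (AE w in M. Y w = 0))"

definition centred_gaussian_field :: "'w measure \<Rightarrow> ('w \<Rightarrow> 'v \<Rightarrow> real) \<Rightarrow> bool" where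
  "centred_gaussian_field M F \<longleftrightarrow>
     (\<forall>S a. finite S \<longrightarrow> centred_gaussian_rv M (\<lambda>w. \<Sum>x\<in>S. a x * F w x))"

definition covariance :: "'w measure \<Rightarrow> ('w \<Rightarrow> 'v \<Rightarrow> real) \<Rightarrow> 'v \<Rightarrow> 'v \<Rightarrow> real" where
  "covariance M F x y = (LINT w|M. F w x * F w y)"

definition isotropic :: "'w measure \<Rightarrow> ('w \<Rightarrow> 'v::real_normed_vector \<Rightarrow> real) \<Rightarrow> bool" where
  "isotropic M F \<longleftrightarrow> (\<exists>K :: real \<Rightarrow> real. \<forall>x y. covariance M F x y = K (norm (x - y)))"

text \<open>
  Sample paths are only required to be \<open>C\<^sup>2\<close>. A moment condition of some finite order
  \<open>p > 4\<close> on the spectral measure gives no more derivatives than that, and infinite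
  differentiability would force all the moments to be finite.
\<close>

definition C2_smooth :: "(real^'n \<Rightarrow> real) \<Rightarrow> bool" where
  "C2_smooth f \<longleftrightarrow> (\<exists>(g :: real^'n \<Rightarrow> real^'n) (H :: real^'n \<Rightarrow> real^'n^'n).
     (\<forall>x. (f has_derivative (\<lambda>h. g x \<bullet> h)) (at x)) \<and>
     (\<forall>x. (g has_derivative (\<lambda>h. H x *v h)) (at x)) \<and>
     continuous_on UNIV H)"

section \<open>Spectral measure\<close>

text \<open>
  The Fourier transform is normalised as the characteristic function
  \<open>x \<mapsto> \<integral> exp (i \<langle>x, \<lambda>\<rangle>) d\<rho>(\<lambda>)\<close>. A factor \<open>2\<pi>\<close> in the exponent would only
  rescale \<open>\<rho>\<close>, which affects none of the conditions imposed on it below.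
\<close>

definition spectral_measure ::
    "'w measure \<Rightarrow> ('w \<Rightarrow> real^'n \<Rightarrow> real) \<Rightarrow> (real^'n) measure \<Rightarrow> bool" where
  "spectral_measure M F \<rho> \<longleftrightarrow> prob_space \<rho> \<and> sets \<rho> = sets borel \<and>
     (\<forall>x y. complex_of_real (covariance M F x y) = (CLINT l|\<rho>. iexp ((x - y) \<bullet> l)))"

definition msupport :: "'a::topological_space measure \<Rightarrow> 'a set" where
  "msupport \<rho> = {x. \<forall>U. open U \<and> x \<in> U \<longrightarrow> emeasure \<rho> U > 0}"

definition rho1 :: "(real^'n) measure \<Rightarrow> bool" where
  "rho1 \<rho> \<longleftrightarrow> (\<forall>x. emeasure \<rho> {x} = 0)"

definition rho2 :: "(real^'n) measure \<Rightarrow> bool" where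
  "rho2 \<rho> \<longleftrightarrow> (\<exists>p>4. integrable \<rho> (\<lambda>l. norm l powr p))"

definition rho3 :: "(real^'n) measure \<Rightarrow> bool" where
  "rho3 \<rho> \<longleftrightarrow> \<not> (\<exists>a. a \<noteq> 0 \<and> msupport \<rho> \<subseteq> {l. a \<bullet> l = 0})"

definition rho4_star :: "(real^'n) measure \<Rightarrow> bool" where
  "rho4_star \<rho> \<longleftrightarrow> interior (msupport \<rho>) \<noteq> {}"

section \<open>Nodal domains and their volume distribution\<close>

definition nodal_domains :: "(real^'n \<Rightarrow> real) \<Rightarrow> (real^'n) set set" where
  "nodal_domains f = components {x. f x \<noteq> 0}"

text \<open>Counting measure is used so that an infinite number of nodal domains counts as \<open>\<infinity>\<close>.\<close>

definition nodal_count :: "(real^'n \<Rightarrow> real) \<Rightarrow> ennreal \<Rightarrow> real \<Rightarrow> ennreal" where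
  "nodal_count f t R = emeasure (count_space UNIV)
     {\<omega> \<in> nodal_domains f. \<omega> \<subseteq> ball 0 R \<and> emeasure lborel \<omega> \<le> t}"

text \<open>
  Convergence in mean, as \<open>R\<close> tends to infinity, of nonnegative random variables to a constant.
  The completion is there because nodal counts are meaningful only outside the null set
  of irregular sample paths, and need not be measurable with respect to \<open>M\<close> itself on that set.
\<close>

definition tendsto_in_mean :: "'w measure \<Rightarrow> (real \<Rightarrow> 'w \<Rightarrow> ennreal) \<Rightarrow> real \<Rightarrow> bool" where
  "tendsto_in_mean M X l \<longleftrightarrow>
     (\<forall>\<^sub>F R in at_top. X R \<in> borel_measurable (completion M)) \<and>
     ((\<lambda>R. \<integral>\<^sup>+w. e2ennreal \<bar>enn2ereal (X R w) - ereal l\<bar> \<partial>completion M) \<longlongrightarrow> 0) at_top"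

text \<open>
  The Nazarov--Sodin constant and the volume distribution function are limits in mean, and
  are introduced through the relation of being the limit.
\<close>

definition nazarov_sodin_constant ::
    "'w measure \<Rightarrow> ('w \<Rightarrow> real^'n \<Rightarrow> real) \<Rightarrow> real \<Rightarrow> bool" where
  "nazarov_sodin_constant M F c \<longleftrightarrow>
     tendsto_in_mean M
       (\<lambda>R w. nodal_count (F w) \<infinity> R / emeasure lborel (ball (0 :: real^'n) R)) c"

definition nodal_volume_distribution ::
    "'w measure \<Rightarrow> ('w \<Rightarrow> real^'n \<Rightarrow> real) \<Rightarrow> real \<Rightarrow> (real \<Rightarrow> real) \<Rightarrow> bool" where
  "nodal_volume_distribution M F c \<Psi> \<longleftrightarrow> (\<forall>t\<ge>0.
     tendsto_in_mean M
       (\<lambda>R w. nodal_count (F w) (ennreal t) R /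
          (ennreal c * emeasure lborel (ball (0 :: real^'n) R))) (\<Psi> t))"

end

theory Submission
  imports Defs
begin

text \<open>
  If the field is positive on a closed ball of radius \<open>a\<close> and negative on the concentric sphere of
  radius \<open>b > a\<close>, it has a nodal domain between the two balls, and \<open>a\<close>, \<open>b\<close> can be chosen so that
  the volume of this domain lies in \<open>(s, t]\<close>. If this event has a probability bounded below uniformly
  in the centre, a packing of \<open>B(R)\<close> by balls of radius \<open>b\<close> gives
  \<open>\<Psi>(t) - \<Psi>(s) > 0\<close> by taking expectations.

  The probability is positive because the locally uniform closure of the span of the translates of the
  covariance contains \<open>x \<mapsto> exp (i \<langle>x, \<lambda>\<rangle>)\<close> for \<open>\<lambda>\<close> in the support of \<open>\<rho>\<close> (by Gaussian weights
  concentrating at \<open>\<lambda>\<close>, which are limits of powers of cosines), then, the support having an interior point, for all \<open>\<lambda>\<close> by Taylor expansion in the frequency, and hence \<open>A - |x|\<^sup>2\<close>.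
  So some linear combination \<open>Z\<close> of field values has \<open>E[Z F(x)] \<ge> 1\<close> on the ball and \<open>\<le> -1\<close> on the
  sphere, and the field has these signs as soon as \<open>Z\<close> is large compared to the part of the field
  that is independent of \<open>Z\<close>.
\<close>

section \<open>Locally uniform limits of translates of the covariance\<close>

text \<open>Since the limits are deterministic and taken in mean, a lower bound on the expected
  number of domains with volume in \<open>(s, t]\<close> suffices, however strongly distant balls
  are correlated. The obstacle is that a sign pattern on an uncountable set must be shown to have
  positive probability. It is tested at countably many points and forced by the single Gaussian
  variable \<open>Z\<close>: the covariance of \<open>Z\<close> with the field is a finite
  combination of translates of the covariance function, and such combinations are rich enough to
  separate a ball from a concentric sphere. Both stationarity of the law and the splitting into
  \<open>Z\<close> and an independent part are reduced to equality of covariances, because these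
  determine the law of a Gaussian family on countably many points.\<close>

inductive_set translates_span :: "('v::real_normed_vector \<Rightarrow> complex) \<Rightarrow> ('v \<Rightarrow> complex) set"
  for k :: "'v \<Rightarrow> complex" where
  zero: "(\<lambda>x. 0) \<in> translates_span k"
| step: "f \<in> translates_span k \<Longrightarrow> (\<lambda>x. f x + c * k (x - y)) \<in> translates_span k"

lemma translates_span_add:
  assumes "f \<in> translates_span k" "g \<in> translates_span k"
  shows "(\<lambda>x. f x + g x) \<in> translates_span k"
  using assms(2)
proof induction
  case zero
  then show ?case using assms(1) by simp
next
  case (step g c y)
  then show ?case
    using translates_span.step[OF step.IH, of c y] by (simp add: add.assoc)
qed

lemma translates_span_scale:
  assumes "f \<in> translates_span k"
  shows "(\<lambda>x. a * f x) \<in> translates_span k"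
  using assms
proof induction
  case zero
  then show ?case using translates_span.zero by simp
next
  case (step g c y)
  then show ?case
    using translates_span.step[OF step.IH, of "a * c" y] by (simp add: algebra_simps)
qed

lemma translates_span_shift:
  assumes "f \<in> translates_span k"
  shows "(\<lambda>x. f (x + z)) \<in> translates_span k"
  using assms
proof induction
  case zero
  show ?case by (rule translates_span.zero)
next
  case (step g c y)
  then show ?case
    using translates_span.step[OF step.IH, of "c" "y - z"] by (simp add: diff_diff_eq2)
qed

lemma translates_span_finite_sum:
  assumes "f \<in> translates_span k"
  shows "\<exists>Y c. finite Y \<and> (\<forall>x. f x = (\<Sum>y\<in>Y. c y * k (x - y)))"
  using assms
proof induction
  case zero
  show ?case by (rule exI[of _ "{}"]) simp
next
  case (step f c y)
  then obtain Y d where Y: "finite Y" "\<And>x. f x = (\<Sum>y\<in>Y. d y * k (x - y))" by blast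
  \<comment> \<open>The new centre \<open>y\<close> may already belong to \<open>Y\<close>; its
    coefficients are then added, so that the sum stays indexed by a set.\<close>
  define d' where "d' z = (if z \<in> Y then d z else 0) + (if z = y then c else 0)" for z
  have "f x + c * k (x - y) = (\<Sum>z\<in>insert y Y. d' z * k (x - z))" for x
  proof -
    have "(\<Sum>z\<in>insert y Y. d' z * k (x - z)) =
      (\<Sum>z\<in>insert y Y. (if z \<in> Y then d z * k (x - z) else 0) + (if z = y then c * k (x - z) else 0))"
      by (intro sum.cong) (auto simp: d'_def algebra_simps)
    also have "\<dots> = (\<Sum>z\<in>insert y Y. if z \<in> Y then d z * k (x - z) else 0) + c * k (x - y)"
      using Y(1) by (simp add: sum.distrib)
    also have "(\<Sum>z\<in>insert y Y. if z \<in> Y then d z * k (x - z) else 0) = (\<Sum>z\<in>Y. d z * k (x - z))"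
      using Y(1) by (intro sum.mono_neutral_cong_right) auto
    finally show ?thesis using Y(2) by simp
  qed
  then show ?case using Y(1) by blast
qed

definition approximable :: "('v::real_normed_vector \<Rightarrow> complex) \<Rightarrow> ('v \<Rightarrow> complex) \<Rightarrow> bool" where
  "approximable k f \<longleftrightarrow>
    (\<forall>r e. e > 0 \<longrightarrow> (\<exists>g\<in>translates_span k. \<forall>x\<in>cball 0 r. cmod (f x - g x) < e))"

lemma approximableE:
  assumes "approximable k f" "e > 0"
  obtains g where "g \<in> translates_span k" "\<And>x. norm x \<le> r \<Longrightarrow> cmod (f x - g x) < e"
proof -
  have "\<exists>g\<in>translates_span k. \<forall>x\<in>cball 0 r. cmod (f x - g x) < e"
    using assms unfolding approximable_def by blast
  then show ?thesis using that by (force simp: mem_cball)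
qed

lemma approximable_add:
  assumes "approximable k f" "approximable k g"
  shows "approximable k (\<lambda>x. f x + g x)"
  unfolding approximable_def
proof (intro allI impI)
  fix r e :: real assume "e > 0"
  then have e: "e / 2 > 0" by simp
  obtain f' where f': "f' \<in> translates_span k" "\<And>x. norm x \<le> r \<Longrightarrow> cmod (f x - f' x) < e / 2"
    using approximableE[OF assms(1) e] by metis
  obtain g' where g': "g' \<in> translates_span k" "\<And>x. norm x \<le> r \<Longrightarrow> cmod (g x - g' x) < e / 2"
    using approximableE[OF assms(2) e] by metis
  have "cmod (f x + g x - (f' x + g' x)) < e" if "norm x \<le> r" for x
    using norm_diff_triangle_ineq[of "f x" "g x" "f' x" "g' x"] f'(2)[OF that] g'(2)[OF that] by linarith
  then show "\<exists>h\<in>translates_span k. \<forall>x\<in>cball 0 r. cmod (f x + g x - h x) < e"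
    using translates_span_add[OF f'(1) g'(1)] by (intro bexI) auto
qed

lemma approximable_scale:
  assumes "approximable k f"
  shows "approximable k (\<lambda>x. a * f x)"
  unfolding approximable_def
proof (intro allI impI)
  fix r e :: real assume "e > 0"
  then have e: "e / (cmod a + 1) > 0"
    by (smt (verit) divide_pos_pos norm_ge_zero)
  obtain f' where f': "f' \<in> translates_span k"
    "\<And>x. norm x \<le> r \<Longrightarrow> cmod (f x - f' x) < e / (cmod a + 1)"
    using approximableE[OF assms(1) e] by metis
  have "cmod (a * f x - a * f' x) < e" if "norm x \<le> r" for x
  proof -
    have "cmod (a * f x - a * f' x) = cmod a * cmod (f x - f' x)"
      by (simp add: norm_mult flip: right_diff_distrib)
    also have "\<dots> \<le> cmod a * (e / (cmod a + 1))"
      using f'(2)[OF that] by (intro mult_left_mono) auto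
    also have "\<dots> < e" using \<open>e > 0\<close>
      by (simp add: field_simps add_pos_nonneg)
    finally show ?thesis .
  qed
  then show "\<exists>h\<in>translates_span k. \<forall>x\<in>cball 0 r. cmod (a * f x - h x) < e"
    using translates_span_scale[OF f'(1), of a] by (intro bexI) auto
qed

lemma approximable_diff:
  assumes "approximable k f" "approximable k g"
  shows "approximable k (\<lambda>x. f x - g x)"
  using approximable_add[OF assms(1) approximable_scale[OF assms(2), of "-1"]] by simp

lemma approximable_sum:
  assumes "\<And>i. i \<in> I \<Longrightarrow> approximable k (f i)"
  shows "approximable k (\<lambda>x. \<Sum>i\<in>I. f i x)"
proof (cases "finite I")
  case True
  then show ?thesis using assms
  proof (induction I)
    case empty
    show ?case using translates_span.zero by (force simp: approximable_def)
  next
    case (insert i I)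
    then show ?case by (simp add: approximable_add)
  qed
next
  case False
  then show ?thesis using translates_span.zero by (force simp: approximable_def)
qed

lemma approximable_shift:
  assumes "approximable k f"
  shows "approximable k (\<lambda>x. f (x + z))"
  unfolding approximable_def
proof (intro allI impI)
  fix r e :: real assume e: "e > 0"
  obtain f' where f': "f' \<in> translates_span k"
    "\<And>x. norm x \<le> r + norm z \<Longrightarrow> cmod (f x - f' x) < e"
    using approximableE[OF assms(1) e] by metis
  have "cmod (f (x + z) - f' (x + z)) < e" if "norm x \<le> r" for x
    using that norm_triangle_ineq[of x z] by (intro f'(2)) linarith
  then show "\<exists>h\<in>translates_span k. \<forall>x\<in>cball 0 r. cmod (f (x + z) - h x) < e"
    using translates_span_shift[OF f'(1), of z] by (intro bexI) auto
qed

text \<open>The closure is itself closed, by an \<open>e / 2\<close> argument. Approximations can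
  therefore be chained without going back to explicit combinations of translates.\<close>

lemma approximable_limit:
  assumes "\<And>r e. e > 0 \<Longrightarrow> \<exists>g. approximable k g \<and> (\<forall>x. norm x \<le> r \<longrightarrow> cmod (f x - g x) < e)"
  shows "approximable k f"
  unfolding approximable_def
proof (intro allI impI)
  fix r e :: real assume "e > 0"
  then have e: "e / 2 > 0" by simp
  obtain g where g: "approximable k g" "\<And>x. norm x \<le> r \<Longrightarrow> cmod (f x - g x) < e / 2"
    using assms[OF e] by blast
  obtain g' where g': "g' \<in> translates_span k" "\<And>x. norm x \<le> r \<Longrightarrow> cmod (g x - g' x) < e / 2"
    using approximableE[OF g(1) e] by metis
  have "cmod (f x - g' x) < e" if "norm x \<le> r" for x
    using g(2)[OF that] g'(2)[OF that] norm_triangle_ineq[of "f x - g x" "g x - g' x"] by simp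
  then show "\<exists>h\<in>translates_span k. \<forall>x\<in>cball 0 r. cmod (f x - h x) < e"
    using g'(1) by (intro bexI) auto
qed

lemma approximable_self: "approximable k k"
proof -
  have "k \<in> translates_span k"
    using translates_span.step[OF translates_span.zero, where k = k and c = 1 and y = 0] by simp
  then show ?thesis unfolding approximable_def by (intro allI impI bexI) auto
qed

text \<open>Differentiation in the frequency: difference quotients stay in the span.\<close>

lemma approximable_iexp_power:
  fixes v :: "'v::euclidean_space"
  assumes "open S" "\<And>l. l \<in> S \<Longrightarrow> approximable k (\<lambda>x. iexp (x \<bullet> l))" "l \<in> S"
  shows "approximable k (\<lambda>x. iexp (x \<bullet> l) * (\<i> * (x \<bullet> v)) ^ m)"
  using assms(3)
\<comment> \<open>The frequency stays arbitrary because the difference quotient in direction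
  \<open>v\<close> also needs the claim at \<open>l + d *\<^sub>R v\<close>; this is where openness
  of \<open>S\<close> enters.\<close>
proof (induction m arbitrary: l)
  case 0
  then show ?case using assms(2) by simp
next
  case (Suc m)
  show ?case
  proof (rule approximable_limit)
    fix r e :: real assume e: "e > 0"
    obtain d0 where d0: "d0 > 0" "ball l d0 \<subseteq> S"
      using assms(1) Suc.prems open_contains_ball by blast
    define R where "R = \<bar>r\<bar> * norm v + 1"
    have R: "R \<ge> 1" by (simp add: R_def)
    \<comment> \<open>The first bound keeps \<open>l + d *\<^sub>R v\<close> in \<open>S\<close>;
      the second turns the second-order Taylor remainder, at most \<open>R ^ (m + 2) * d / 2\<close>
      on the ball of radius \<open>r\<close>, into at most \<open>e / 2\<close>.\<close>
    define d where "d = min (d0 / (2 * (norm v + 1))) (e / R ^ (m + 2))"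
    have d: "d > 0" using d0 e R by (auto simp: d_def intro!: divide_pos_pos add_nonneg_pos)
    have "d * norm v \<le> d0 / (2 * (norm v + 1)) * norm v"
      by (intro mult_right_mono) (auto simp: d_def)
    also have "\<dots> < d0"
    proof -
      have "d0 * norm v < d0 * (2 * (norm v + 1))" using d0 by (intro mult_strict_left_mono) (auto intro: add_nonneg_pos)
      moreover have "0 < norm v + 1" by (simp add: add_nonneg_pos)
      ultimately show ?thesis by (simp add: field_simps)
    qed
    finally have "l + d *\<^sub>R v \<in> S"
      using d0 d by (intro subsetD[OF d0(2)]) (auto simp: dist_norm)
    define g where "g x = (1 / complex_of_real d) *
       (iexp (x \<bullet> (l + d *\<^sub>R v)) * (\<i> * (x \<bullet> v)) ^ m - iexp (x \<bullet> l) * (\<i> * (x \<bullet> v)) ^ m)" for x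
    have "approximable k g"
      unfolding g_def using Suc.IH[OF \<open>l + d *\<^sub>R v \<in> S\<close>] Suc.IH[OF Suc.prems]
      by (intro approximable_scale approximable_diff)
    moreover have "cmod (iexp (x \<bullet> l) * (\<i> * (x \<bullet> v)) ^ Suc m - g x) < e" if x: "norm x \<le> r" for x
    proof -
      define u where "u = x \<bullet> v"
      have u: "\<bar>u\<bar> \<le> R"
        using Cauchy_Schwarz_ineq2[of x v] mult_right_mono[OF x, of "norm v"]
        by (simp add: u_def R_def) (smt (verit) mult_right_mono norm_ge_zero)
      have split: "iexp (x \<bullet> (l + d *\<^sub>R v)) = iexp (x \<bullet> l) * iexp (d * u)"
        by (simp add: u_def inner_right_distrib distrib_left exp_add)
      have "iexp (x \<bullet> l) * (\<i> * u) ^ Suc m - g x =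
         - (iexp (x \<bullet> l) * (\<i> * u) ^ m / d * (iexp (d * u) - (1 + \<i> * (d * u))))"
        using d by (simp add: g_def split[unfolded] u_def[symmetric] field_simps)
      then have "cmod (iexp (x \<bullet> l) * (\<i> * u) ^ Suc m - g x) =
         \<bar>u\<bar> ^ m / d * cmod (iexp (d * u) - (1 + \<i> * (d * u)))"
        using d by (simp add: norm_mult norm_power norm_divide)
      also have "\<dots> \<le> \<bar>u\<bar> ^ m / d * ((d * u)\<^sup>2 / 2)"
        using iexp_approx1[of "d * u" 1] d
        by (intro mult_left_mono) (auto simp: numeral_2_eq_2)
      also have "\<dots> = \<bar>u\<bar> ^ (m + 2) * d / 2"
        using d by (simp add: power_add power2_eq_square field_simps flip: abs_mult)
      also have "\<dots> \<le> R ^ (m + 2) * d / 2"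
        using u d by (intro divide_right_mono mult_right_mono power_mono) auto
      also have "\<dots> \<le> e / 2"
      proof -
        have "d \<le> e / R ^ (m + 2)" by (simp add: d_def)
        then show ?thesis using R by (simp add: field_simps)
      qed
      also have "\<dots> < e" using e by simp
      finally show ?thesis by (simp add: u_def)
    qed
    ultimately show "\<exists>g. approximable k g \<and>
        (\<forall>x. norm x \<le> r \<longrightarrow> cmod (iexp (x \<bullet> l) * (\<i> * (x \<bullet> v)) ^ Suc m - g x) < e)" by blast
  qed
qed

text \<open>Expand \<open>iexp (x \<bullet> (m - l))\<close> in its power series: every partial sum,
  times \<open>iexp (x \<bullet> l)\<close>, consists of frequency derivatives at \<open>l\<close>,
  and convergence is uniform for bounded \<open>x\<close>. The distance from \<open>l\<close> to
  \<open>m\<close> is immaterial, as the remainder is divided by a factorial.\<close>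

lemma approximable_iexp_everywhere:
  fixes l m :: "'v::euclidean_space"
  assumes "open S" "\<And>l. l \<in> S \<Longrightarrow> approximable k (\<lambda>x. iexp (x \<bullet> l))" "l \<in> S"
  shows "approximable k (\<lambda>x. iexp (x \<bullet> m))"
proof (rule approximable_limit)
  fix r e :: real assume e: "e > 0"
  define v where "v = m - l"
  define R where "R = \<bar>r\<bar> * norm v"
  have lim: "(\<lambda>n. R ^ n / fact n) \<longlonglongrightarrow> 0"
    using summable_LIMSEQ_zero[OF summable_exp[of R]] by (simp add: divide_inverse mult.commute)
  have "\<forall>\<^sub>F n in sequentially. R ^ Suc n / fact (Suc n) < e"
    by (rule order_tendstoD(2)[OF LIMSEQ_Suc[OF lim] e])
  then obtain n where n: "R ^ Suc n / fact (Suc n) < e"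
    using eventually_happens'[OF sequentially_bot] by blast
  define g where "g x = (\<Sum>j\<le>n. (1 / fact j) * (iexp (x \<bullet> l) * (\<i> * (x \<bullet> v)) ^ j))" for x
  have "approximable k g" unfolding g_def
    by (intro approximable_sum approximable_scale approximable_iexp_power[OF assms])
  moreover have "cmod (iexp (x \<bullet> m) - g x) < e" if x: "norm x \<le> r" for x
  proof -
    have u: "\<bar>x \<bullet> v\<bar> \<le> R"
      using Cauchy_Schwarz_ineq2[of x v] x
      by (simp add: R_def) (smt (verit) mult_right_mono norm_ge_zero)
    have "g x = iexp (x \<bullet> l) * (\<Sum>j\<le>n. (\<i> * (x \<bullet> v)) ^ j / fact j)"
      by (simp add: g_def sum_distrib_left)
    moreover have "iexp (x \<bullet> m) = iexp (x \<bullet> l) * iexp (x \<bullet> v)"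
      by (simp add: v_def inner_diff_right right_diff_distrib flip: exp_add)
    ultimately have "cmod (iexp (x \<bullet> m) - g x) =
        cmod (iexp (x \<bullet> v) - (\<Sum>j\<le>n. (\<i> * (x \<bullet> v)) ^ j / fact j))"
      by (simp add: norm_mult flip: right_diff_distrib)
    also have "\<dots> \<le> \<bar>x \<bullet> v\<bar> ^ Suc n / fact (Suc n)"
      using iexp_approx1[of "x \<bullet> v" n] by simp
    also have "\<dots> \<le> R ^ Suc n / fact (Suc n)"
      using u by (intro divide_right_mono power_mono) auto
    also note n
    finally show ?thesis .
  qed
  ultimately show "\<exists>g. approximable k g \<and> (\<forall>x. norm x \<le> r \<longrightarrow> cmod (iexp (x \<bullet> m) - g x) < e)" by blast
qed

lemma approximable_paraboloid:
  fixes l :: "'v::euclidean_space"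
  assumes "open S" "\<And>l. l \<in> S \<Longrightarrow> approximable k (\<lambda>x. iexp (x \<bullet> l))" "l \<in> S"
  shows "approximable k (\<lambda>x. complex_of_real (A - (norm x)\<^sup>2))"
proof -
  \<comment> \<open>Expanding at frequency 0, where the character is 1, leaves bare monomials;
    \<open>\<i>\<close> squares to the minus sign in front of the squared norm. Frequency 0 need not
    lie in \<open>S\<close>, hence the passage to all frequencies beforehand.\<close>
  have *: "approximable k (\<lambda>x. (\<i> * (x \<bullet> v)) ^ j)" for v :: 'v and j
    using approximable_iexp_power[OF open_UNIV, of k 0 v j] approximable_iexp_everywhere[OF assms] by simp
  have "approximable k (\<lambda>x. A * (\<i> * (x \<bullet> (0::'v))) ^ 0 + (\<Sum>b\<in>Basis. (\<i> * (x \<bullet> b)) ^ 2))"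
    by (intro approximable_add approximable_scale approximable_sum *)
  moreover have "A * (\<i> * (x \<bullet> (0::'v))) ^ 0 + (\<Sum>b\<in>Basis. (\<i> * (x \<bullet> b)) ^ 2) =
      complex_of_real (A - (norm x)\<^sup>2)" for x
    by (simp add: power_mult_distrib sum_negf power2_norm_eq_inner euclidean_inner[of x x])
       (simp add: power2_eq_square)
  ultimately show ?thesis by simp
qed

section \<open>Characters in the support of the spectral measure\<close>

text \<open>Up to third order \<open>cos v\<close> is \<open>1 - v\<^sup>2 / 2\<close>, and
  \<open>n\<close>-th powers of numbers in [-1, 1] differ by at most \<open>n\<close> times the
  difference of the bases. With \<open>v = u / sqrt n\<close> the total error is of order
  \<open>1 / sqrt n\<close>, and the powers of \<open>1 - u\<^sup>2 / (2 * n)\<close> converge to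
  the Gaussian.\<close>

lemma cos_power_tendsto_gauss: "(\<lambda>n. cos (u / sqrt (real n)) ^ n) \<longlonglongrightarrow> exp (- u\<^sup>2 / 2)"
proof -
  have cos3: "\<bar>cos v - (1 - v\<^sup>2 / 2)\<bar> \<le> \<bar>v\<bar> ^ 3 / 6" for v :: real
  proof -
    have "cmod (iexp v - (1 + \<i> * v + (\<i> * v)\<^sup>2 / 2)) \<le> \<bar>v\<bar> ^ 3 / 6"
      using iexp_approx1[of v 2] by (simp add: numeral_2_eq_2 numeral_3_eq_3 fact_numeral)
    then have "\<bar>Re (iexp v - (1 + \<i> * v + (\<i> * v)\<^sup>2 / 2))\<bar> \<le> \<bar>v\<bar> ^ 3 / 6"
      using abs_Re_le_cmod order_trans by blast
    then show ?thesis by (simp add: Re_exp power_mult_distrib)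
  qed
  have "(\<lambda>n. \<bar>u\<bar> ^ 3 / 6 * (1 / sqrt (real n))) \<longlonglongrightarrow> \<bar>u\<bar> ^ 3 / 6 * 0"
    by (intro tendsto_mult tendsto_const tendsto_divide_0[OF tendsto_const]
        filterlim_at_top_imp_at_infinity filterlim_compose[OF sqrt_at_top] filterlim_real_sequentially)
  then have lim: "(\<lambda>n. \<bar>u\<bar> ^ 3 / 6 * (1 / sqrt (real n))) \<longlonglongrightarrow> 0" by simp
  have "(\<lambda>n. cos (u / sqrt (real n)) ^ n - (1 + (- u\<^sup>2 / 2) / real n) ^ n) \<longlonglongrightarrow> 0"
  proof (rule Lim_null_comparison[OF _ lim])
    have "norm (cos (u / sqrt (real n)) ^ n - (1 + (- u\<^sup>2 / 2) / real n) ^ n)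
        \<le> \<bar>u\<bar> ^ 3 / 6 * (1 / sqrt (real n))" if n: "n > nat \<lceil>u\<^sup>2\<rceil>" for n
    proof -
      have n0: "n > 0" using n by simp
      have "u\<^sup>2 / real n \<le> 1"
      proof -
        have "u\<^sup>2 \<le> real n" using n by linarith
        then show ?thesis using n0 by simp
      qed
      then have "\<bar>1 + (- u\<^sup>2 / 2) / real n\<bar> \<le> 1"
        using n0 by (simp add: abs_le_iff)
      then have "norm (cos (u / sqrt (real n)) ^ n - (1 + (- u\<^sup>2 / 2) / real n) ^ n)
          \<le> n * norm (cos (u / sqrt (real n)) - (1 + (- u\<^sup>2 / 2) / real n))"
        by (intro norm_power_diff) auto
      also have "\<dots> \<le> real n * (\<bar>u / sqrt (real n)\<bar> ^ 3 / 6)"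
      proof -
        have expand: "1 + (- u\<^sup>2 / 2) / real n = 1 - (u / sqrt (real n))\<^sup>2 / 2"
          by (simp add: power_divide)
        show ?thesis
          unfolding expand real_norm_def by (rule mult_left_mono[OF cos3]) simp
      qed
      also have "\<dots> = \<bar>u\<bar> ^ 3 / 6 * (1 / sqrt (real n))"
      proof -
        have "sqrt (real n) ^ 3 = real n * sqrt (real n)" by (simp add: power3_eq_cube)
        then have "real n / sqrt (real n) ^ 3 = 1 / sqrt (real n)" using n0 by simp
        then have "\<bar>u\<bar> ^ 3 / 6 * (real n / sqrt (real n) ^ 3) = \<bar>u\<bar> ^ 3 / 6 * (1 / sqrt (real n))" by simp
        then show ?thesis by (simp add: abs_divide power_divide mult.commute)
      qed
      finally show ?thesis .
    qed
    then show "\<forall>\<^sub>F n in sequentially. norm (cos (u / sqrt (real n)) ^ n - (1 + (- u\<^sup>2 / 2) / real n) ^ n)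
        \<le> \<bar>u\<bar> ^ 3 / 6 * (1 / sqrt (real n))"
      by (rule eventually_mono[OF eventually_gt_at_top])
  qed
  from tendsto_add[OF this tendsto_exp_limit_sequentially[of "- u\<^sup>2 / 2"]]
  show ?thesis by simp
qed

text \<open>The Fourier transform of the complex measure with density \<open>\<phi>\<close> relative
  to \<open>\<rho>\<close>. For a spectral measure, the weight 1 gives the covariance function, the
  kernel whose translates are considered.\<close>

definition fourier_weight :: "'v::euclidean_space measure \<Rightarrow> ('v \<Rightarrow> complex) \<Rightarrow> 'v \<Rightarrow> complex" where
  "fourier_weight \<rho> \<phi> x = (CLINT l|\<rho>. \<phi> l * iexp (x \<bullet> l))"

definition admissible_weight :: "'v::euclidean_space measure \<Rightarrow> ('v \<Rightarrow> complex) \<Rightarrow> bool" where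
  "admissible_weight \<rho> \<phi> \<longleftrightarrow> \<phi> \<in> borel_measurable borel \<and> (\<exists>B. \<forall>l. cmod (\<phi> l) \<le> B) \<and>
     approximable (fourier_weight \<rho> (\<lambda>l. 1)) (fourier_weight \<rho> \<phi>)"

context
  fixes \<rho> :: "'v::euclidean_space measure"
  assumes prob: "prob_space \<rho>" and sets_eq: "sets \<rho> = sets borel"
begin

interpretation prob_space \<rho> by (rule prob)

lemma weight_measurable:
  assumes "\<phi> \<in> borel_measurable borel"
  shows "\<phi> \<in> borel_measurable \<rho>"
  using assms by (simp add: measurable_cong_sets[OF sets_eq refl])

lemma weight_integrable:
  fixes \<phi> :: "'v \<Rightarrow> complex"
  assumes "\<phi> \<in> borel_measurable borel" "\<And>l. cmod (\<phi> l) \<le> B"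
  shows "integrable \<rho> (\<lambda>l. \<phi> l * iexp (x \<bullet> l))"
proof (rule integrable_const_bound[of _ B])
  show "AE l in \<rho>. cmod (\<phi> l * iexp (x \<bullet> l)) \<le> B" using assms(2) by (simp add: norm_mult)
  have "(\<lambda>l. \<phi> l * iexp (x \<bullet> l)) \<in> borel_measurable borel" using assms(1) by measurable
  then show "(\<lambda>l. \<phi> l * iexp (x \<bullet> l)) \<in> borel_measurable \<rho>" by (rule weight_measurable)
qed

lemma admissible_one: "admissible_weight \<rho> (\<lambda>l. 1)"
  by (auto simp: admissible_weight_def approximable_self)

lemma admissible_add:
  assumes "admissible_weight \<rho> f" "admissible_weight \<rho> g"
  shows "admissible_weight \<rho> (\<lambda>l. f l + g l)"
proof -
  obtain A B where b: "\<And>l. cmod (f l) \<le> A" "\<And>l. cmod (g l) \<le> B"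
    using assms by (auto simp: admissible_weight_def)
  have [measurable]: "f \<in> borel_measurable borel" "g \<in> borel_measurable borel"
    using assms by (auto simp: admissible_weight_def)
  have "fourier_weight \<rho> (\<lambda>l. f l + g l) = (\<lambda>x. fourier_weight \<rho> f x + fourier_weight \<rho> g x)"
    unfolding fourier_weight_def
    by (intro ext) (simp add: distrib_right weight_integrable[OF _ b(1)] weight_integrable[OF _ b(2)])
  moreover have "cmod (f l + g l) \<le> A + B" for l
    using norm_triangle_mono[OF b] .
  moreover have "(\<lambda>l. f l + g l) \<in> borel_measurable borel" by measurable
  ultimately show ?thesis
    using assms by (auto simp: admissible_weight_def intro: approximable_add)
qed

text \<open>A factor \<open>iexp (y \<bullet> l)\<close> in the weight moves the argument of the
  transform by \<open>y\<close>, and shifts preserve approximability: translation in space is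
  multiplication by characters in frequency.\<close>

lemma admissible_mult_character:
  assumes "admissible_weight \<rho> f"
  shows "admissible_weight \<rho> (\<lambda>l. c * iexp (y \<bullet> l) * f l)"
proof -
  obtain A where b: "\<And>l. cmod (f l) \<le> A"
    using assms by (auto simp: admissible_weight_def)
  have [measurable]: "f \<in> borel_measurable borel"
    using assms by (auto simp: admissible_weight_def)
  have "fourier_weight \<rho> (\<lambda>l. c * iexp (y \<bullet> l) * f l) = (\<lambda>x. c * fourier_weight \<rho> f (x + y))"
    unfolding fourier_weight_def
    by (intro ext) (simp add: inner_add_left distrib_left exp_add mult_ac
        flip: integral_mult_right_zero)
  moreover have "cmod (c * iexp (y \<bullet> l) * f l) \<le> cmod c * A" for l
    using b[of l] by (simp add: norm_mult mult_left_mono)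
  moreover have "(\<lambda>l. c * iexp (y \<bullet> l) * f l) \<in> borel_measurable borel" by measurable
  ultimately show ?thesis
    using assms by (auto simp: admissible_weight_def intro!: approximable_scale approximable_shift)
qed

lemma admissible_mult_cos:
  assumes "admissible_weight \<rho> f"
  shows "admissible_weight \<rho> (\<lambda>l. complex_of_real (cos (y \<bullet> l - t)) * f l)"
proof -
  have "admissible_weight \<rho> (\<lambda>l. iexp (-t) / 2 * iexp (y \<bullet> l) * f l + iexp t / 2 * iexp ((-y) \<bullet> l) * f l)"
    by (intro admissible_add admissible_mult_character assms)
  moreover have "iexp (-t) / 2 * iexp (y \<bullet> l) * f l + iexp t / 2 * iexp ((-y) \<bullet> l) * f l
      = complex_of_real (cos (y \<bullet> l - t)) * f l" for l
  proof -
    have "complex_of_real (cos (y \<bullet> l - t)) = (iexp (y \<bullet> l - t) + iexp (- (y \<bullet> l - t))) / 2"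
      by (simp add: cos_exp_eq algebra_simps flip: cos_of_real)
    also have "\<dots> = iexp (-t) / 2 * iexp (y \<bullet> l) + iexp t / 2 * iexp ((-y) \<bullet> l)"
      by (simp add: algebra_simps add_divide_distrib flip: exp_add)
    finally show ?thesis by (simp add: algebra_simps)
  qed
  ultimately show ?thesis by simp
qed

text \<open>Bounded pointwise convergence of weights gives convergence in mean with respect to
  \<open>\<rho>\<close>, and the mean distance of two weights bounds the distance of their
  transforms uniformly in \<open>x\<close>.\<close>

lemma admissible_limit:
  assumes "\<And>j. admissible_weight \<rho> (f j)" "\<And>j l. cmod (f j l) \<le> B"
    "\<And>l. (\<lambda>j. f j l) \<longlonglongrightarrow> g l"
  shows "admissible_weight \<rho> g"
proof -
  have f[measurable]: "f j \<in> borel_measurable borel" for j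
    using assms(1)[of j] by (auto simp: admissible_weight_def)
  have g[measurable]: "g \<in> borel_measurable borel"
    by (rule borel_measurable_LIMSEQ_metric[OF f assms(3)])
  have gB: "cmod (g l) \<le> B" for l
    using LIMSEQ_le_const2[OF tendsto_norm[OF assms(3)[of l]]] assms(2) by blast
  have [measurable]: "f j \<in> borel_measurable \<rho>" "g \<in> borel_measurable \<rho>" for j
    by (auto intro: weight_measurable)
  have int: "integrable \<rho> (\<lambda>l. cmod (f j l - g l))" for j
  proof (rule integrable_const_bound[of _ "2 * B"])
    show "AE l in \<rho>. norm (cmod (f j l - g l)) \<le> 2 * B"
      using norm_triangle_ineq4[of "f j _" "g _"] assms(2) gB by (intro AE_I2) (smt (verit) norm_ge_zero real_norm_def)
  qed measurable
  have lim: "(\<lambda>j. LINT l|\<rho>. cmod (f j l - g l)) \<longlonglongrightarrow> (LINT l|\<rho>. 0)"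
  proof (rule integral_dominated_convergence[where w = "\<lambda>_. 2 * B"])
    show "AE l in \<rho>. (\<lambda>j. cmod (f j l - g l)) \<longlonglongrightarrow> 0"
      using assms(3) by (intro AE_I2 tendsto_norm_zero) (simp add: LIM_zero)
    show "AE l in \<rho>. norm (cmod (f j l - g l)) \<le> 2 * B" for j
      using norm_triangle_ineq4[of "f j _" "g _"] assms(2) gB by (intro AE_I2) (smt (verit) norm_ge_zero real_norm_def)
  qed auto
  have "approximable (fourier_weight \<rho> (\<lambda>l. 1)) (fourier_weight \<rho> g)"
  proof (rule approximable_limit)
    fix r e :: real assume "e > 0"
    then obtain j where j: "(LINT l|\<rho>. cmod (f j l - g l)) < e"
      using order_tendstoD(2)[OF lim, of e] by (auto simp: eventually_sequentially)
    have "cmod (fourier_weight \<rho> g x - fourier_weight \<rho> (f j) x) < e" for x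
    proof -
      have "fourier_weight \<rho> g x - fourier_weight \<rho> (f j) x = (CLINT l|\<rho>. (g l - f j l) * iexp (x \<bullet> l))"
        unfolding fourier_weight_def left_diff_distrib
        by (rule Bochner_Integration.integral_diff[symmetric])
           (use weight_integrable[OF g gB] weight_integrable[OF f assms(2)] in auto)
      also have "cmod \<dots> \<le> (LINT l|\<rho>. cmod ((g l - f j l) * iexp (x \<bullet> l)))"
        by (rule integral_norm_bound)
      also have "\<dots> = (LINT l|\<rho>. cmod (f j l - g l))"
        by (simp add: norm_mult norm_minus_commute)
      finally show ?thesis using j by simp
    qed
    then show "\<exists>h. approximable (fourier_weight \<rho> (\<lambda>l. 1)) h \<and>
        (\<forall>x. norm x \<le> r \<longrightarrow> cmod (fourier_weight \<rho> g x - h x) < e)"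
      using assms(1)[of j] by (auto simp: admissible_weight_def)
  qed
  then show ?thesis using g gB by (auto simp: admissible_weight_def)
qed

lemma admissible_mult_gauss:
  assumes "admissible_weight \<rho> f"
  shows "admissible_weight \<rho> (\<lambda>l. complex_of_real (exp (- (y \<bullet> (l - m))\<^sup>2 / 2)) * f l)"
proof -
  \<comment> \<open>Scale \<open>j\<close> and exponent \<open>k\<close> are kept apart so that the
    induction on \<open>k\<close> multiplies by the same cosine each time; the limit is then taken
    along the diagonal \<open>h j (Suc j)\<close>.\<close>
  define h where "h j k l = complex_of_real (cos (y \<bullet> (l - m) / sqrt (real (Suc j))) ^ k) * f l" for j k and l :: 'v
  have "admissible_weight \<rho> (h j k)" for j k
  proof (induction k)
    case 0
    then show ?case using assms by (simp add: h_def)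
  next
    case (Suc k)
    have "h j (Suc k) l =
       complex_of_real (cos ((1 / sqrt (real (Suc j))) *\<^sub>R y \<bullet> l - y \<bullet> m / sqrt (real (Suc j)))) * h j k l" for l
      by (simp add: h_def inner_diff_right diff_divide_distrib)
    then show ?case using admissible_mult_cos[OF Suc.IH] by presburger
  qed
  then have h: "admissible_weight \<rho> (h j (Suc j))" for j .
  obtain B where B: "\<And>l. cmod (f l) \<le> B"
    using assms by (auto simp: admissible_weight_def)
  show ?thesis
  proof (rule admissible_limit[OF h, where B = B])
    show "cmod (h j (Suc j) l) \<le> B" for j l
    proof -
      have "cmod (h j (Suc j) l) = \<bar>cos (y \<bullet> (l - m) / sqrt (real (Suc j)))\<bar> ^ Suc j * cmod (f l)"
        by (simp add: h_def norm_mult norm_power abs_mult power_abs del: of_real_power of_real_mult of_nat_Suc)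
      also have "\<dots> \<le> 1 * cmod (f l)"
        by (intro mult_right_mono power_le_one) auto
      finally show ?thesis using B[of l] by simp
    qed
    show "(\<lambda>j. h j (Suc j) l) \<longlonglongrightarrow> complex_of_real (exp (- (y \<bullet> (l - m))\<^sup>2 / 2)) * f l" for l
      unfolding h_def by (intro tendsto_mult tendsto_const tendsto_of_real
        LIMSEQ_Suc[OF cos_power_tendsto_gauss])
  qed
qed

text \<open>The Gaussian factorises over the basis: each \<open>b\<close> contributes a Gaussian in
  the direction \<open>sqrt (2 * T) *\<^sub>R b\<close>, where the 2 cancels the 1/2 in the
  exponent.\<close>

lemma admissible_gauss:
  "admissible_weight \<rho> (\<lambda>l. complex_of_real (exp (- T * (norm (l - m))\<^sup>2)))" if "T \<ge> 0"
proof -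
  have "admissible_weight \<rho> (\<lambda>l. complex_of_real (exp (\<Sum>b\<in>A. - T * ((l - m) \<bullet> b)\<^sup>2)))"
    if "finite A" for A :: "'v set"
    using that
  proof induction
    case empty
    then show ?case using admissible_one by simp
  next
    case (insert b A)
    have "exp (\<Sum>b\<in>insert b A. - T * ((l - m) \<bullet> b)\<^sup>2) =
      exp (- ((sqrt (2 * T) *\<^sub>R b) \<bullet> (l - m))\<^sup>2 / 2) * exp (\<Sum>b\<in>A. - T * ((l - m) \<bullet> b)\<^sup>2)" for l
      using insert.hyps \<open>T \<ge> 0\<close>
      by (simp add: power_mult_distrib inner_commute flip: exp_add)
    then show ?case using admissible_mult_gauss[OF insert.IH] by (simp only: of_real_mult)
  qed
  from this[OF finite_Basis]
  moreover have "(norm z)\<^sup>2 = (\<Sum>b\<in>Basis. (z \<bullet> b)\<^sup>2)" for z :: 'v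
    by (subst power2_norm_eq_inner, subst euclidean_inner) (simp add: power2_eq_square)
  ultimately show ?thesis by (simp add: sum_distrib_left sum_negf)
qed

text \<open>Divided by their integrals, the Gaussian weights form an approximate identity at
  \<open>m\<close> relative to \<open>\<rho>\<close>. The support gives mass \<open>p > 0\<close> to
  the ball of radius \<open>h / 2\<close>, where the weight is at least
  \<open>exp (- T * (h / 2)\<^sup>2)\<close>; beyond radius \<open>h\<close> it is at most
  \<open>exp (- T * h\<^sup>2)\<close>, which is negligible in comparison for large
  \<open>T\<close>.\<close>

lemma approximable_iexp_support:
  assumes "m \<in> msupport \<rho>"
  shows "approximable (fourier_weight \<rho> (\<lambda>l. 1)) (\<lambda>x. iexp (x \<bullet> m))"
proof (rule approximable_limit)
  fix r e :: real assume e: "e > 0"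
  \<comment> \<open>For \<open>norm x \<le> r\<close> and \<open>l\<close> within \<open>h\<close>
    of \<open>m\<close> the two characters differ by at most
    \<open>(\<bar>r\<bar> + 1) * h = e / 2\<close>.\<close>
  define h where "h = e / (2 * (\<bar>r\<bar> + 1))"
  have h: "h > 0" using e by (auto simp: h_def intro!: divide_pos_pos add_nonneg_pos)
  define p where "p = prob (ball m (h / 2))"
  have ball_sets: "ball m (h / 2) \<in> events" by (simp add: sets_eq)
  have p: "p > 0"
  proof -
    have "emeasure \<rho> (ball m (h / 2)) > 0" using assms h by (auto simp: msupport_def)
    then show ?thesis by (simp add: p_def emeasure_eq_measure)
  qed
  \<comment> \<open>The rate \<open>3 / 4 * h\<^sup>2\<close> is
    \<open>h\<^sup>2 - (h / 2)\<^sup>2\<close>, the gap between the two decay rates; the 2 bounds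
    the difference of two characters.\<close>
  have "((\<lambda>T. 2 / p * exp (- (3 / 4 * h\<^sup>2) * T)) \<longlongrightarrow> 2 / p * 0) at_top"
    using h by (intro tendsto_mult tendsto_const filterlim_compose[OF exp_at_bot]
      filterlim_tendsto_neg_mult_at_bot[OF tendsto_const]) (auto simp: filterlim_ident)
  then have "\<forall>\<^sub>F T in at_top. 2 / p * exp (- (3 / 4 * h\<^sup>2) * T) < e / 2"
    using e by (intro order_tendstoD(2)) auto
  then have "\<forall>\<^sub>F T in at_top. T > 0 \<and> 2 / p * exp (- (3 / 4 * h\<^sup>2) * T) < e / 2"
    by (intro eventually_conj eventually_gt_at_top)
  then obtain T where T: "T > 0" "2 / p * exp (- (3 / 4 * h\<^sup>2) * T) < e / 2"
    using eventually_happens'[OF trivial_limit_at_top_linorder] by blast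
  define W where "W l = exp (- T * (norm (l - m))\<^sup>2)" for l
  have W[measurable]: "W \<in> borel_measurable borel" unfolding W_def by measurable
  have W\<rho>[measurable]: "W \<in> borel_measurable \<rho>" by (simp add: measurable_cong_sets[OF sets_eq refl] W)
  have Wb: "0 < W l" "W l \<le> 1" for l using T by (auto simp: W_def)
  have intW: "integrable \<rho> W"
    using Wb by (intro integrable_const_bound[of _ 1]) (auto simp: less_imp_le)
  define s where "s = (LINT l|\<rho>. W l)"
  have s: "exp (- T * (h / 2)\<^sup>2) * p \<le> s"
  proof -
    have "exp (- T * (h / 2)\<^sup>2) * p = (LINT l|\<rho>. exp (- T * (h / 2)\<^sup>2) * indicator (ball m (h/2)) l)"
      using ball_sets by (simp add: p_def)
    also have "\<dots> \<le> s" unfolding s_def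
    proof (rule integral_mono)
      show "integrable \<rho> (\<lambda>l. exp (- T * (h / 2)\<^sup>2) * indicator (ball m (h/2)) l)"
        using ball_sets by (intro integrable_mult_right) (simp add: emeasure_eq_measure)
      fix l
      show "exp (- T * (h / 2)\<^sup>2) * indicator (ball m (h/2)) l \<le> W l"
      proof (cases "l \<in> ball m (h/2)")
        case True
        then have "norm (l - m) \<le> h / 2" by (simp add: dist_norm norm_minus_commute)
        then have "(norm (l - m))\<^sup>2 \<le> (h/2)\<^sup>2" by (intro power_mono) auto
        then show ?thesis using True T by (simp add: W_def)
      next
        case False
        then show ?thesis using Wb[of l] by simp
      qed
    qed (rule intW)
    finally show ?thesis .
  qed
  have s0: "s > 0" using s p by (smt (verit) exp_gt_zero mult_pos_pos)
  define g where "g x = (1 / complex_of_real s) * fourier_weight \<rho> (\<lambda>l. complex_of_real (W l)) x" for x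
  have "approximable (fourier_weight \<rho> (\<lambda>l. 1)) g"
    using admissible_gauss[of T m] T unfolding g_def W_def
    by (intro approximable_scale) (auto simp: admissible_weight_def)
  moreover have "cmod (iexp (x \<bullet> m) - g x) < e" if x: "norm x \<le> r" for x
  proof -
    have int1: "integrable \<rho> (\<lambda>l. complex_of_real (W l) * iexp (x \<bullet> l))"
      by (rule weight_integrable[of _ 1]) (use Wb in \<open>auto simp: less_imp_le\<close>)
    have int2: "integrable \<rho> (\<lambda>l. complex_of_real (W l) * iexp (x \<bullet> m))"
      using intW by (intro integrable_mult_left integrable_of_real)
    have "s *\<^sub>R (iexp (x \<bullet> m) - g x) =
       (CLINT l|\<rho>. complex_of_real (W l) * iexp (x \<bullet> m)) - (CLINT l|\<rho>. complex_of_real (W l) * iexp (x \<bullet> l))"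
      using s0 by (simp add: g_def fourier_weight_def s_def scaleR_conv_of_real right_diff_distrib)
    also have "\<dots> = (CLINT l|\<rho>. complex_of_real (W l) * (iexp (x \<bullet> m) - iexp (x \<bullet> l)))"
      using int1 int2 by (simp add: right_diff_distrib)
    finally have "s * cmod (iexp (x \<bullet> m) - g x) =
        cmod (CLINT l|\<rho>. complex_of_real (W l) * (iexp (x \<bullet> m) - iexp (x \<bullet> l)))"
      using s0 by (metis abs_of_pos norm_scaleR)
    also have "\<dots> \<le> (LINT l|\<rho>. W l * (e / 2) + 2 * exp (- T * h\<^sup>2))"
    proof (rule Bochner_Integration.integral_norm_bound_integral)
      show "integrable \<rho> (\<lambda>l. complex_of_real (W l) * (iexp (x \<bullet> m) - iexp (x \<bullet> l)))"
        unfolding right_diff_distrib using int1 int2 by (intro Bochner_Integration.integrable_diff)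
      show "integrable \<rho> (\<lambda>l. W l * (e / 2) + 2 * exp (- T * h\<^sup>2))"
        using intW by (intro Bochner_Integration.integrable_add integrable_mult_left integrable_const)
      fix l
      have eq: "cmod (complex_of_real (W l) * (iexp (x \<bullet> m) - iexp (x \<bullet> l))) = W l * cmod (iexp (x \<bullet> m) - iexp (x \<bullet> l))"
        using Wb[of l] by (simp add: norm_mult)
      show "cmod (complex_of_real (W l) * (iexp (x \<bullet> m) - iexp (x \<bullet> l))) \<le> W l * (e / 2) + 2 * exp (- T * h\<^sup>2)"
      proof (cases "norm (l - m) \<le> h")
        case True
        have "cmod (iexp (x \<bullet> m) - iexp (x \<bullet> l)) = cmod (iexp (x \<bullet> l) * (iexp (x \<bullet> (m - l)) - 1))"
          by (simp add: right_diff_distrib inner_diff_right flip: exp_add)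
        also have "\<dots> = cmod (iexp (x \<bullet> (m - l)) - 1)" by (simp add: norm_mult)
        also have "\<dots> \<le> \<bar>x \<bullet> (m - l)\<bar>" using iexp_approx1[of "x \<bullet> (m - l)" 0] by simp
        also have "\<dots> \<le> norm x * norm (l - m)"
          using Cauchy_Schwarz_ineq2[of x "m - l"] by (simp add: norm_minus_commute)
        also have "\<dots> \<le> (\<bar>r\<bar> + 1) * h" using x True by (intro mult_mono) auto
        also have "\<dots> = e / 2" by (simp add: h_def field_simps)
        finally show ?thesis using Wb[of l] eq
          by (smt (verit) exp_gt_zero mult_left_mono)
      next
        case False
        then have "h\<^sup>2 \<le> (norm (l - m))\<^sup>2" using h by (intro power_mono) auto
        then have "W l \<le> exp (- T * h\<^sup>2)" using T by (simp add: W_def)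
        moreover have "cmod (iexp (x \<bullet> m) - iexp (x \<bullet> l)) \<le> 2"
          using norm_triangle_ineq4[of "iexp (x \<bullet> m)" "iexp (x \<bullet> l)"] by simp
        ultimately have "W l * cmod (iexp (x \<bullet> m) - iexp (x \<bullet> l)) \<le> exp (- T * h\<^sup>2) * 2"
          using Wb[of l] by (intro mult_mono) auto
        then show ?thesis using eq Wb[of l] e by (smt (verit) divide_pos_pos mult_nonneg_nonneg)
      qed
    qed
    also have "\<dots> = s * (e / 2) + 2 * exp (- T * h\<^sup>2)"
      using intW by (simp add: s_def prob_space)
    finally have A: "s * cmod (iexp (x \<bullet> m) - g x) \<le> s * (e / 2) + 2 * exp (- T * h\<^sup>2)" .
    have "2 * exp (- T * h\<^sup>2) = (exp (- T * (h / 2)\<^sup>2) * p) * (2 / p * exp (- (3 / 4 * h\<^sup>2) * T))"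
    proof -
      have "exp (- T * h\<^sup>2) = exp (- T * (h / 2)\<^sup>2) * exp (- (3 / 4 * h\<^sup>2) * T)"
        by (simp add: power2_eq_square algebra_simps flip: exp_add)
      then show ?thesis using p by simp
    qed
    also have "\<dots> < (exp (- T * (h / 2)\<^sup>2) * p) * (e / 2)"
      using p T(2) by (intro mult_strict_left_mono) auto
    also have "\<dots> \<le> s * (e / 2)" using s e by (intro mult_right_mono) auto
    finally have "s * cmod (iexp (x \<bullet> m) - g x) < s * e" using A by (simp add: field_simps)
    then show ?thesis using s0 by simp
  qed
  ultimately show "\<exists>g. approximable (fourier_weight \<rho> (\<lambda>l. 1)) g \<and>
      (\<forall>x. norm x \<le> r \<longrightarrow> cmod (iexp (x \<bullet> m) - g x) < e)" by blast
qed

end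

lemma separating_combination:
  fixes \<rho> :: "'v::euclidean_space measure" and K :: "'v \<Rightarrow> real"
  assumes "prob_space \<rho>" "sets \<rho> = sets borel" "interior (msupport \<rho>) \<noteq> {}"
    and K: "\<And>z. complex_of_real (K z) = (CLINT l|\<rho>. iexp (z \<bullet> l))"
    and "0 \<le> a" "a < b"
  obtains Y c where "finite Y"
    "\<And>x. norm x \<le> a \<Longrightarrow> (\<Sum>y\<in>Y. c y * K (x - y)) \<ge> 1"
    "\<And>x. norm x = b \<Longrightarrow> (\<Sum>y\<in>Y. c y * K (x - y)) \<le> - 1"
proof -
  let ?k = "fourier_weight \<rho> (\<lambda>l. 1)"
  \<comment> \<open>\<open>A\<close> is halfway between the squared radii:
    \<open>A - (norm x)\<^sup>2\<close> is at least \<open>2 * e\<close> on the inner ball and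
    equals \<open>- 2 * e\<close> on the sphere. An error below \<open>e\<close> leaves at least
    \<open>e\<close> of each sign, and dividing by \<open>e\<close> gives the margin 1.\<close>
  define A where "A = (a\<^sup>2 + b\<^sup>2) / 2"
  define e where "e = (b\<^sup>2 - a\<^sup>2) / 4"
  have e: "e > 0" using assms(5,6) by (simp add: e_def power_strict_mono)
  have kK: "?k z = complex_of_real (K z)" for z by (simp add: fourier_weight_def K)
  obtain m where "m \<in> interior (msupport \<rho>)" using assms(3) by blast
  then have ap: "approximable ?k (\<lambda>x. complex_of_real (A - (norm x)\<^sup>2))"
    using approximable_iexp_support[OF assms(1,2)] interior_subset
    by (intro approximable_paraboloid[OF open_interior]) blast+
  obtain g where g: "g \<in> translates_span ?k"
    "\<And>x. norm x \<le> b \<Longrightarrow> cmod (complex_of_real (A - (norm x)\<^sup>2) - g x) < e"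
    by (rule approximableE[OF ap e, where r = b]) blast
  obtain Y d where Y: "finite Y" "\<And>x. g x = (\<Sum>y\<in>Y. d y * ?k (x - y))"
    using translates_span_finite_sum[OF g(1)] by blast
  \<comment> \<open>The approximation is complex, but \<open>K\<close> is real, so taking real parts
    only affects the coefficients.\<close>
  define c where "c y = Re (d y) / e" for y
  have sum: "(\<Sum>y\<in>Y. c y * K (x - y)) = Re (g x) / e" for x
    by (simp add: Y(2) kK c_def sum_divide_distrib)
  have close: "\<bar>A - (norm x)\<^sup>2 - Re (g x)\<bar> < e" if "norm x \<le> b" for x
    using g(2)[OF that] abs_Re_le_cmod[of "complex_of_real (A - (norm x)\<^sup>2) - g x"] by simp
  show ?thesis
  proof (rule that[OF Y(1)])
    fix x :: 'v assume "norm x \<le> a"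
    then have "norm x \<le> b" "(norm x)\<^sup>2 \<le> a\<^sup>2" using assms(5,6) by (auto intro: power_mono)
    moreover have "A - a\<^sup>2 = 2 * e" by (simp add: A_def e_def field_simps)
    ultimately have "Re (g x) \<ge> e" using close[of x] by linarith
    then show "(\<Sum>y\<in>Y. c y * K (x - y)) \<ge> 1" using e by (simp add: sum)
  next
    fix x :: 'v assume "norm x = b"
    moreover have "A - b\<^sup>2 = - 2 * e" by (simp add: A_def e_def field_simps)
    ultimately have "Re (g x) \<le> - e" using close[of x] by simp
    then show "(\<Sum>y\<in>Y. c y * K (x - y)) \<le> - 1" using e by (simp add: sum field_simps)
  qed
qed

section \<open>Uniqueness of finite dimensional distributions\<close>

lemma (in prob_space) integral_weighted_distr:
  fixes g X :: "'a \<Rightarrow> real" and f :: "real \<Rightarrow> 'b::{banach, second_countable_topology}"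
  assumes [measurable]: "g \<in> borel_measurable M" "X \<in> borel_measurable M" "f \<in> borel_measurable borel"
    and "\<And>w. 0 \<le> g w" "0 \<le> m"
  shows "(\<integral>x. f x \<partial>distr (density M (\<lambda>w. ennreal (g w / m))) borel X) =
    (1 / m) *\<^sub>R (\<integral>w. g w *\<^sub>R f (X w) \<partial>M)"
proof -
  have "(\<integral>x. f x \<partial>distr (density M (\<lambda>w. ennreal (g w / m))) borel X) = (\<integral>w. (g w / m) *\<^sub>R f (X w) \<partial>M)"
    using assms(4,5) by (subst integral_distr) (auto simp: integral_density)
  also have "\<dots> = (\<integral>w. (1 / m) *\<^sub>R (g w *\<^sub>R f (X w)) \<partial>M)" by simp
  finally show ?thesis by (simp only: integral_scaleR_right)
qed

lemma (in prob_space) real_distribution_weighted: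
  fixes g X :: "'a \<Rightarrow> real"
  assumes [measurable]: "g \<in> borel_measurable M" "X \<in> borel_measurable M"
    and "\<And>w. 0 \<le> g w" "\<And>w. g w \<le> C" "m = (\<integral>w. g w \<partial>M)" "m > 0"
  shows "real_distribution (distr (density M (\<lambda>w. ennreal (g w / m))) borel X)"
proof -
  have int: "integrable M g" by (rule integrable_const_bound[of _ C]) (use assms in auto)
  have "(\<integral>\<^sup>+ w. ennreal (g w / m) \<partial>M) = ennreal (\<integral>w. g w / m \<partial>M)"
    using int assms(3,6) by (intro nn_integral_eq_integral) auto
  also have "(\<integral>w. g w / m \<partial>M) = 1" using assms(5,6) by simp
  finally have "prob_space (density M (\<lambda>w. ennreal (g w / m)))"
    by (intro prob_spaceI) (simp add: emeasure_density cong: nn_integral_cong)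
  then interpret D: prob_space "density M (\<lambda>w. ennreal (g w / m))" .
  show ?thesis by (rule D.real_distribution_distr) simp
qed

text \<open>The case \<open>t = 0\<close> shows that both weights have the same total mass. Divided
  by it they define two laws on the line with equal characteristic functions, so Levy's uniqueness
  theorem applies. With total mass 0, nonnegative weights vanish almost everywhere.\<close>

lemma weighted_char_unique:
  fixes g X :: "'a \<Rightarrow> real" and h Y :: "'b \<Rightarrow> real"
  assumes M: "prob_space M" and N: "prob_space N"
    and [measurable]: "g \<in> borel_measurable M" "X \<in> borel_measurable M"
      "h \<in> borel_measurable N" "Y \<in> borel_measurable N" "B \<in> sets borel"
    and g: "\<And>w. 0 \<le> g w" "\<And>w. g w \<le> C" and h: "\<And>w. 0 \<le> h w" "\<And>w. h w \<le> C"
    and eq: "\<And>t. (CLINT w|M. complex_of_real (g w) * iexp (t * X w)) = (CLINT w|N. complex_of_real (h w) * iexp (t * Y w))"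
  shows "(LINT w|M. g w * indicator B (X w)) = (LINT w|N. h w * indicator B (Y w))"
proof -
  interpret M: prob_space M by fact
  interpret N: prob_space N by fact
  have intg: "integrable M g" by (rule M.integrable_const_bound[of _ C]) (use g in auto)
  have inth: "integrable N h" by (rule N.integrable_const_bound[of _ C]) (use h in auto)
  define m where "m = (LINT w|M. g w)"
  have m: "m = (LINT w|N. h w)" using eq[of 0] by (simp add: m_def)
  have "m \<ge> 0" unfolding m_def using g by (intro Bochner_Integration.integral_nonneg) auto
  then consider "m = 0" | "m > 0" by linarith
  then show ?thesis
  proof cases
    case 1
    have "AE w in M. g w = 0" "AE w in N. h w = 0"
      using 1 m_def m g h by (simp_all flip: integral_nonneg_eq_0_iff_AE[OF intg] integral_nonneg_eq_0_iff_AE[OF inth])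
    then have "(LINT w|M. g w * indicator B (X w)) = (LINT w|M. 0)"
      "(LINT w|N. h w * indicator B (Y w)) = (LINT w|N. 0)"
      by (intro integral_cong_AE; auto)+
    then show ?thesis by simp
  next
    case 2
    let ?P = "distr (density M (\<lambda>w. ennreal (g w / m))) borel X"
    let ?Q = "distr (density N (\<lambda>w. ennreal (h w / m))) borel Y"
    have "char ?P = char ?Q"
    proof
      fix t
      have f: "(\<lambda>x. iexp (t * x)) \<in> borel_measurable borel" by measurable
      have "char ?P t = (1 / m) *\<^sub>R (\<integral>w. g w *\<^sub>R iexp (t * X w) \<partial>M)"
        unfolding char_def using g 2 by (intro M.integral_weighted_distr f) auto
      moreover have "char ?Q t = (1 / m) *\<^sub>R (\<integral>w. h w *\<^sub>R iexp (t * Y w) \<partial>N)"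
        unfolding char_def using h 2 by (intro N.integral_weighted_distr f) auto
      ultimately show "char ?P t = char ?Q t"
        using eq[of t] by (simp add: scaleR_conv_of_real)
    qed
    then have "?P = ?Q"
      using Levy_uniqueness M.real_distribution_weighted[OF _ _ g m_def 2]
        N.real_distribution_weighted[OF _ _ h m 2] by simp
    have f: "(\<lambda>x. indicator B x :: real) \<in> borel_measurable borel" by measurable
    have "(\<integral>x. indicator B x \<partial>?P) = (1 / m) *\<^sub>R (\<integral>w. g w *\<^sub>R indicat_real B (X w) \<partial>M)"
      using g 2 by (intro M.integral_weighted_distr f) auto
    moreover have "(\<integral>x. indicator B x \<partial>?Q) = (1 / m) *\<^sub>R (\<integral>w. h w *\<^sub>R indicat_real B (Y w) \<partial>N)"
      using h 2 by (intro N.integral_weighted_distr f) auto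
    ultimately show ?thesis using 2 \<open>?P = ?Q\<close> by simp
  qed
qed

text \<open>The first two identities express the characteristic functions under the nonnegative
  weights \<open>1 + cos\<close> and \<open>1 + sin\<close> through integrals of pure exponentials;
  the third returns from these weights to the exponential.\<close>

lemma (in prob_space) trig_weight_expand:
  fixes u p x :: "'a \<Rightarrow> real"
  assumes [measurable]: "u \<in> borel_measurable M" "p \<in> borel_measurable M" "x \<in> borel_measurable M"
    and u: "\<And>w. 0 \<le> u w" "\<And>w. u w \<le> 1"
  shows "(CLINT w|M. complex_of_real (u w * (1 + cos (p w))) * iexp (t * x w)) =
      (CLINT w|M. u w * iexp (0 * p w + t * x w)) +
      ((CLINT w|M. u w * iexp (1 * p w + t * x w)) + (CLINT w|M. u w * iexp ((-1) * p w + t * x w))) / 2"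
    and "(CLINT w|M. complex_of_real (u w * (1 + sin (p w))) * iexp (t * x w)) =
      (CLINT w|M. u w * iexp (0 * p w + t * x w)) +
      ((CLINT w|M. u w * iexp (1 * p w + t * x w)) - (CLINT w|M. u w * iexp ((-1) * p w + t * x w))) / (2 * \<i>)"
    and "(CLINT w|M. complex_of_real (u w) * iexp (p w)) =
      complex_of_real ((LINT w|M. u w * (1 + cos (p w))) - (LINT w|M. u w)) +
      \<i> * complex_of_real ((LINT w|M. u w * (1 + sin (p w))) - (LINT w|M. u w))"
proof -
  have int: "integrable M (\<lambda>w. complex_of_real (u w) * iexp (s * p w + t * x w))" for s t
    using u by (intro integrable_const_bound[of _ 1]) (auto simp: norm_mult)
  have cos: "complex_of_real (cos a) = (iexp a + iexp (- a)) / 2" for a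
    by (simp add: cos_exp_eq flip: cos_of_real)
  have sin: "complex_of_real (sin a) = (iexp a - iexp (- a)) / (2 * \<i>)" for a
    by (simp add: sin_exp_eq flip: sin_of_real)
  have sp: "iexp (0 * a + b) = iexp b" "iexp (1 * a + b) = iexp a * iexp b"
    "iexp ((-1) * a + b) = iexp (- a) * iexp b" for a b :: real
    by (simp_all add: algebra_simps flip: exp_add)
  have alg: "U * (1 + (A + A') / 2) * E = U * E + (U * (A * E) + U * (A' * E)) / 2"
    "U * (1 + (A - A') / (2 * \<i>)) * E = U * E + (U * (A * E) - U * (A' * E)) / (2 * \<i>)" for U A A' E :: complex
    by (simp_all add: field_simps)
  have "(CLINT w|M. complex_of_real (u w * (1 + cos (p w))) * iexp (t * x w)) =
     (CLINT w|M. u w * iexp (0 * p w + t * x w) +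
        (u w * iexp (1 * p w + t * x w) + u w * iexp ((-1) * p w + t * x w)) / 2)"
    by (intro Bochner_Integration.integral_cong refl)
      (simp only: sp, simp only: of_real_mult of_real_add of_real_1 cos alg)
  then show "(CLINT w|M. complex_of_real (u w * (1 + cos (p w))) * iexp (t * x w)) =
      (CLINT w|M. u w * iexp (0 * p w + t * x w)) +
      ((CLINT w|M. u w * iexp (1 * p w + t * x w)) + (CLINT w|M. u w * iexp ((-1) * p w + t * x w))) / 2"
    by (simp only: Bochner_Integration.integral_add[OF int Bochner_Integration.integrable_divide[OF Bochner_Integration.integrable_add[OF int int]]]
      integral_divide_zero Bochner_Integration.integral_add[OF int int])
  have "(CLINT w|M. complex_of_real (u w * (1 + sin (p w))) * iexp (t * x w)) =
     (CLINT w|M. u w * iexp (0 * p w + t * x w) +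
        (u w * iexp (1 * p w + t * x w) - u w * iexp ((-1) * p w + t * x w)) / (2 * \<i>))"
    by (intro Bochner_Integration.integral_cong refl)
      (simp only: sp, simp only: of_real_mult of_real_add of_real_1 sin alg)
  then show "(CLINT w|M. complex_of_real (u w * (1 + sin (p w))) * iexp (t * x w)) =
      (CLINT w|M. u w * iexp (0 * p w + t * x w)) +
      ((CLINT w|M. u w * iexp (1 * p w + t * x w)) - (CLINT w|M. u w * iexp ((-1) * p w + t * x w))) / (2 * \<i>)"
    by (simp only: Bochner_Integration.integral_add[OF int Bochner_Integration.integrable_divide[OF Bochner_Integration.integrable_diff[OF int int]]]
      integral_divide_zero Bochner_Integration.integral_diff[OF int int])
  have iu: "integrable M u" using u by (intro integrable_const_bound[of _ 1]) auto
  have ic: "integrable M (\<lambda>w. u w * cos (p w))" and isn: "integrable M (\<lambda>w. u w * sin (p w))"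
    using u by (intro integrable_const_bound[of _ 1] AE_I2; simp add: abs_mult mult_le_one)+
  have "(CLINT w|M. complex_of_real (u w) * iexp (p w)) =
     (CLINT w|M. complex_of_real (u w * cos (p w)) + \<i> * complex_of_real (u w * sin (p w)))"
    by (intro Bochner_Integration.integral_cong refl)
       (simp add: complex_eq_iff Re_exp Im_exp)
  also have "\<dots> = complex_of_real (LINT w|M. u w * cos (p w)) + \<i> * complex_of_real (LINT w|M. u w * sin (p w))"
    using ic isn by (subst Bochner_Integration.integral_add) (auto simp del: of_real_mult)
  finally show "(CLINT w|M. complex_of_real (u w) * iexp (p w)) =
      complex_of_real ((LINT w|M. u w * (1 + cos (p w))) - (LINT w|M. u w)) +
      \<i> * complex_of_real ((LINT w|M. u w * (1 + sin (p w))) - (LINT w|M. u w))"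
    using iu ic isn by (simp add: distrib_left)
qed

text \<open>
  Cramer--Wold: one coordinate at a time is turned from a frequency into an indicator, by the
  one-dimensional uniqueness theorem for the measures weighted with \<open>1 + cos\<close> and \<open>1 + sin\<close>
  of the remaining frequencies; adding 1 keeps the weights nonnegative.
\<close>

lemma finite_dim_char_unique:
  fixes X :: "'i \<Rightarrow> 'a \<Rightarrow> real" and Y :: "'i \<Rightarrow> 'b \<Rightarrow> real"
  assumes M: "prob_space M" and N: "prob_space N"
    and X[measurable]: "\<And>i. X i \<in> borel_measurable M" and Y[measurable]: "\<And>i. Y i \<in> borel_measurable N"
    and eq: "\<And>T b. finite T \<Longrightarrow>
      (CLINT w|M. iexp (\<Sum>i\<in>T. b i * X i w)) = (CLINT w|N. iexp (\<Sum>i\<in>T. b i * Y i w))"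
    and B[measurable]: "\<And>i. B i \<in> sets borel"
    and "finite S" "finite T"
  shows "(CLINT w|M. complex_of_real (\<Prod>i\<in>S. indicator (B i) (X i w)) * iexp (\<Sum>i\<in>T. b i * X i w)) =
    (CLINT w|N. complex_of_real (\<Prod>i\<in>S. indicator (B i) (Y i w)) * iexp (\<Sum>i\<in>T. b i * Y i w))"
  using \<open>finite S\<close> \<open>finite T\<close>
proof (induction S arbitrary: T b)
  case empty
  then show ?case using eq by simp
next
  case (insert j S)
  interpret M: prob_space M by fact
  interpret N: prob_space N by fact
  have one_plus_trig: "0 \<le> 1 + cos a" "0 \<le> 1 + sin a" for a :: real
    using cos_ge_minus_one[of a] sin_ge_minus_one[of a] by linarith+
  have prod_bound: "x * y \<le> 2" if "0 \<le> x" "x \<le> 1" "0 \<le> y" "y \<le> 2" for x y :: real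
    using mult_mono[of x 1 y 2] that by simp
  define u where "u w = (\<Prod>i\<in>S. indicator (B i) (X i w) :: real)" for w
  define u' where "u' w = (\<Prod>i\<in>S. indicator (B i) (Y i w) :: real)" for w
  define p where "p w = (\<Sum>i\<in>T. b i * X i w)" for w
  define p' where "p' w = (\<Sum>i\<in>T. b i * Y i w)" for w
  have [measurable]: "u \<in> borel_measurable M" "u' \<in> borel_measurable N"
    "p \<in> borel_measurable M" "p' \<in> borel_measurable N"
    unfolding u_def u'_def p_def p'_def by measurable
  have u: "0 \<le> u w" "u w \<le> 1" for w
    by (auto simp: u_def intro!: prod_nonneg prod_le_1)
  have u': "0 \<le> u' w" "u' w \<le> 1" for w
    by (auto simp: u'_def intro!: prod_nonneg prod_le_1)
  \<comment> \<open>The induction hypothesis with an additional frequency \<open>t\<close> at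
    coordinate \<open>j\<close>, which is why \<open>T\<close> and \<open>b\<close> are arbitrary.
    The values 0, 1 and -1 of \<open>s\<close> feed the expansions of the trigonometric
    weights.\<close>
  have J: "(CLINT w|M. u w * iexp (s * p w + t * X j w)) = (CLINT w|N. u' w * iexp (s * p' w + t * Y j w))" for s t
  proof -
    define b' where "b' i = s * (if i \<in> T then b i else 0) + (if i = j then t else 0)" for i
    have comb: "(\<Sum>i\<in>insert j T. b' i * z i) = s * (\<Sum>i\<in>T. b i * z i) + t * z j" for z :: "'i \<Rightarrow> real"
    proof -
      have "(\<Sum>i\<in>insert j T. b' i * z i) =
          (\<Sum>i\<in>insert j T. s * ((if i \<in> T then b i else 0) * z i)) + (\<Sum>i\<in>insert j T. if i = j then t * z i else 0)"
        by (subst sum.distrib[symmetric]) (intro sum.cong; auto simp: b'_def distrib_right)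
      also have "(\<Sum>i\<in>insert j T. if i = j then t * z i else 0) = t * z j"
        using insert.prems by (subst sum.delta) auto
      also have "(\<Sum>i\<in>insert j T. s * ((if i \<in> T then b i else 0) * z i)) = (\<Sum>i\<in>T. s * (b i * z i))"
        using insert.prems by (intro sum.mono_neutral_cong_right) auto
      finally show ?thesis by (simp add: sum_distrib_left)
    qed
    show ?thesis
      using insert.IH[of "insert j T" b'] insert.prems
      unfolding comb u_def[symmetric] u'_def[symmetric] p_def[symmetric] p'_def[symmetric] by simp
  qed
  have 1: "(LINT w|M. u w * indicator (B j) (X j w)) = (LINT w|N. u' w * indicator (B j) (Y j w))"
    by (rule weighted_char_unique[OF M N, where C = 1]) (use u u' J[of 0] in auto)
  have 2: "(LINT w|M. (u w * (1 + cos (p w))) * indicator (B j) (X j w)) =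
      (LINT w|N. (u' w * (1 + cos (p' w))) * indicator (B j) (Y j w))"
  proof (rule weighted_char_unique[OF M N, where C = 2])
    show "(CLINT w|M. complex_of_real (u w * (1 + cos (p w))) * iexp (t * X j w)) =
        (CLINT w|N. complex_of_real (u' w * (1 + cos (p' w))) * iexp (t * Y j w))" for t
      by (subst M.trig_weight_expand(1), simp_all only: u, measurable)
         (subst N.trig_weight_expand(1), simp_all only: u' J, measurable)
    show "0 \<le> u w * (1 + cos (p w))" for w
      by (intro mult_nonneg_nonneg u(1) one_plus_trig)
    show "0 \<le> u' w * (1 + cos (p' w))" for w
      by (intro mult_nonneg_nonneg u'(1) one_plus_trig)
    show "u w * (1 + cos (p w)) \<le> 2" for w by (intro prod_bound u one_plus_trig) simp
    show "u' w * (1 + cos (p' w)) \<le> 2" for w by (intro prod_bound u' one_plus_trig) simp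
  qed measurable
  have 3: "(LINT w|M. (u w * (1 + sin (p w))) * indicator (B j) (X j w)) =
      (LINT w|N. (u' w * (1 + sin (p' w))) * indicator (B j) (Y j w))"
  proof (rule weighted_char_unique[OF M N, where C = 2])
    show "(CLINT w|M. complex_of_real (u w * (1 + sin (p w))) * iexp (t * X j w)) =
        (CLINT w|N. complex_of_real (u' w * (1 + sin (p' w))) * iexp (t * Y j w))" for t
      by (subst M.trig_weight_expand(2), simp_all only: u, measurable)
         (subst N.trig_weight_expand(2), simp_all only: u' J, measurable)
    show "0 \<le> u w * (1 + sin (p w))" for w
      by (intro mult_nonneg_nonneg u(1) one_plus_trig)
    show "0 \<le> u' w * (1 + sin (p' w))" for w
      by (intro mult_nonneg_nonneg u'(1) one_plus_trig)
    show "u w * (1 + sin (p w)) \<le> 2" for w by (intro prod_bound u one_plus_trig) simp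
    show "u' w * (1 + sin (p' w)) \<le> 2" for w by (intro prod_bound u' one_plus_trig) simp
  qed measurable
  \<comment> \<open>The indicator of coordinate \<open>j\<close> now joins the weight; facts 1 to 3
    supply the real integrals on the right of the third identity.\<close>
  define v where "v w = indicator (B j) (X j w) * u w" for w
  define v' where "v' w = indicator (B j) (Y j w) * u' w" for w
  have [measurable]: "v \<in> borel_measurable M" "v' \<in> borel_measurable N"
    unfolding v_def v'_def by measurable
  have v: "0 \<le> v w" "v w \<le> 1" for w using u[of w] by (auto simp: v_def indicator_def)
  have v': "0 \<le> v' w" "v' w \<le> 1" for w using u'[of w] by (auto simp: v'_def indicator_def)
  have "(CLINT w|M. complex_of_real (v w) * iexp (p w)) =
      complex_of_real ((LINT w|M. v w * (1 + cos (p w))) - (LINT w|M. v w)) +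
      \<i> * complex_of_real ((LINT w|M. v w * (1 + sin (p w))) - (LINT w|M. v w))"
    by (rule M.trig_weight_expand(3)[where x = p]) (simp_all add: v)
  moreover have "(CLINT w|N. complex_of_real (v' w) * iexp (p' w)) =
      complex_of_real ((LINT w|N. v' w * (1 + cos (p' w))) - (LINT w|N. v' w)) +
      \<i> * complex_of_real ((LINT w|N. v' w * (1 + sin (p' w))) - (LINT w|N. v' w))"
    by (rule N.trig_weight_expand(3)[where x = p']) (simp_all add: v')
  ultimately have "(CLINT w|M. complex_of_real (v w) * iexp (p w)) = (CLINT w|N. complex_of_real (v' w) * iexp (p' w))"
    using 1 2 3 by (simp add: v_def v'_def mult_ac)
  then show ?case
    using insert.hyps by (simp add: v_def v'_def u_def u'_def p_def p'_def)
qed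

text \<open>Continuity from above: the events on the first \<open>n\<close> coordinates decrease to
  the full one. Written as integrals of products of indicators, their probabilities can be compared
  across two probability spaces.\<close>

lemma (in prob_space) prob_all_limit:
  fixes Z :: "nat \<Rightarrow> 'a \<Rightarrow> real"
  assumes [measurable]: "\<And>i. Z i \<in> borel_measurable M" "\<And>i. B i \<in> sets borel"
  shows "(\<lambda>n. LINT w|M. (\<Prod>i<n. indicator (B i) (Z i w)) :: real)
    \<longlonglongrightarrow> prob {w \<in> space M. \<forall>i. Z i w \<in> B i}"
proof -
    let ?A = "\<lambda>n. {w \<in> space M. \<forall>i<n. Z i w \<in> B i}"
  have [measurable]: "?A n \<in> events" for n by measurable
  have "(LINT w|M. (\<Prod>i<n. indicator (B i) (Z i w)) :: real) = measure M (?A n)" for n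
  proof -
    have "(LINT w|M. (\<Prod>i<n. indicator (B i) (Z i w)) :: real) = (LINT w|M. indicator (?A n) w)"
    proof (intro Bochner_Integration.integral_cong refl)
      fix w assume w: "w \<in> space M"
      show "(\<Prod>i<n. indicator (B i) (Z i w)) = (indicator (?A n) w :: real)"
      proof (cases "\<forall>i<n. Z i w \<in> B i")
        case True
        then show ?thesis using w by simp
      next
        case False
        then have "(\<Prod>i<n. indicator (B i) (Z i w)) = (0::real)"
          by (intro prod_zero) (auto simp: indicator_def)
        then show ?thesis using False by simp
      qed
    qed
    then show ?thesis by simp
  qed
  moreover have "(\<lambda>n. measure M (?A n)) \<longlonglongrightarrow> measure M (\<Inter>n. ?A n)"
    by (intro finite_Lim_measure_decseq) (auto simp: decseq_def)
  moreover have "(\<Inter>n. ?A n) = {w \<in> space M. \<forall>i. Z i w \<in> B i}" by auto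
  ultimately show ?thesis by simp
qed

lemma prob_all_eq:
  fixes X :: "nat \<Rightarrow> 'a \<Rightarrow> real" and Y :: "nat \<Rightarrow> 'b \<Rightarrow> real"
  assumes M: "prob_space M" and N: "prob_space N"
    and X[measurable]: "\<And>i. X i \<in> borel_measurable M" and Y[measurable]: "\<And>i. Y i \<in> borel_measurable N"
    and eq: "\<And>T b. finite T \<Longrightarrow>
      (CLINT w|M. iexp (\<Sum>i\<in>T. b i * X i w)) = (CLINT w|N. iexp (\<Sum>i\<in>T. b i * Y i w))"
    and B[measurable]: "\<And>i. B i \<in> sets borel"
  shows "measure M {w \<in> space M. \<forall>i. X i w \<in> B i} = measure N {w \<in> space N. \<forall>i. Y i w \<in> B i}"
proof -
  have "(LINT w|M. (\<Prod>i<n. indicator (B i) (X i w)) :: real) = (LINT w|N. (\<Prod>i<n. indicator (B i) (Y i w)))" for n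
  proof -
    have "(CLINT w|M. complex_of_real (\<Prod>i<n. indicator (B i) (X i w))) =
        (CLINT w|N. complex_of_real (\<Prod>i<n. indicator (B i) (Y i w)))"
      using finite_dim_char_unique[where B = B and S = "{..<n}" and T = "{}", OF M N X Y eq B] by simp
    then show ?thesis by (simp only: integral_complex_of_real of_real_eq_iff)
  qed
  moreover have "(\<lambda>n. LINT w|M. (\<Prod>i<n. indicator (B i) (X i w)) :: real)
      \<longlonglongrightarrow> measure M {w \<in> space M. \<forall>i. X i w \<in> B i}"
    by (rule prob_space.prob_all_limit[OF M X B])
  ultimately show ?thesis
    using prob_space.prob_all_limit[OF N Y B] by (simp add: LIMSEQ_unique)
qed

section \<open>Gaussian fields\<close>

lemma (in prob_space) centred_gaussian_rv_square_integrable: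
  assumes "centred_gaussian_rv M Y"
  shows "integrable M (\<lambda>w. (Y w)\<^sup>2)"
proof -
  have [measurable]: "Y \<in> borel_measurable M" using assms by (simp add: centred_gaussian_rv_def)
  consider (normal) \<sigma> where "\<sigma> > 0" "distributed M lborel Y (\<lambda>x. ennreal (normal_density 0 \<sigma> x))"
    | (zero) "AE w in M. Y w = 0"
    using assms by (auto simp: centred_gaussian_rv_def)
  then show ?thesis
  proof cases
    case normal
    have "integrable lborel (\<lambda>x. normal_density 0 \<sigma> x * (x - 0) ^ 2)"
      by (rule integrable_normal_moment[OF normal(1)])
    then show ?thesis
      using distributed_integrable[OF normal(2), of "\<lambda>x. x ^ 2"] by simp
  next
    case zero
    then show ?thesis by (subst integrable_cong_AE[where g = "\<lambda>_. 0"]) auto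
  qed
qed

text \<open>In the degenerate case the variance is 0 and both sides are 1, so one formula serves for
  all linear combinations of field values.\<close>

lemma (in prob_space) centred_gaussian_rv_char:
  assumes "centred_gaussian_rv M Y"
  shows "(CLINT w|M. iexp (Y w)) = complex_of_real (exp (- (LINT w|M. (Y w)\<^sup>2) / 2))"
proof -
  have [measurable]: "Y \<in> borel_measurable M" using assms by (simp add: centred_gaussian_rv_def)
  consider (normal) \<sigma> where "\<sigma> > 0" "distributed M lborel Y (\<lambda>x. ennreal (normal_density 0 \<sigma> x))"
    | (zero) "AE w in M. Y w = 0"
    using assms by (auto simp: centred_gaussian_rv_def)
  then show ?thesis
  proof cases
    case normal
    have "expectation Y = 0" by (rule normal_distributed_expectation[OF normal])
    then have var: "(LINT w|M. (Y w)\<^sup>2) = \<sigma>\<^sup>2"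
      using normal_distributed_variance[OF normal] by simp
    have D: "distributed M lborel (\<lambda>w. Y w / \<sigma>) (\<lambda>x. ennreal (std_normal_density x))"
      using normal normal_standard_normal_convert[of \<sigma> Y 0] by simp
    have "(CLINT w|M. iexp (Y w)) = (CLINT w|M. iexp (\<sigma> * (Y w / \<sigma>)))"
      using normal(1) by simp
    also have "\<dots> = (CLINT x|distr M lborel (\<lambda>w. Y w / \<sigma>). iexp (\<sigma> * x))"
      by (subst integral_distr) auto
    also have "distr M lborel (\<lambda>w. Y w / \<sigma>) = std_normal_distribution"
      using D by (simp add: distributed_def)
    also have "(CLINT x|std_normal_distribution. iexp (\<sigma> * x)) = char std_normal_distribution \<sigma>"
      by (simp add: char_def)
    finally show ?thesis by (simp add: char_std_normal_distribution var)
  next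
    case zero
    have "(CLINT w|M. iexp (Y w)) = (CLINT w|M. 1)"
      using zero by (intro integral_cong_AE) auto
    moreover have "(LINT w|M. (Y w)\<^sup>2) = (LINT w|M. 0)"
      using zero by (intro integral_cong_AE) auto
    ultimately show ?thesis by (simp add: prob_space)
  qed
qed

lemma integrable_mult_of_squares:
  fixes f g :: "'a \<Rightarrow> real"
  assumes [measurable]: "f \<in> borel_measurable M" "g \<in> borel_measurable M"
    and "integrable M (\<lambda>w. (f w)\<^sup>2)" "integrable M (\<lambda>w. (g w)\<^sup>2)"
  shows "integrable M (\<lambda>w. f w * g w)"
proof (rule Bochner_Integration.integrable_bound[OF Bochner_Integration.integrable_add[OF assms(3,4)]])
  have "\<bar>a * b\<bar> \<le> a\<^sup>2 + b\<^sup>2" for a b :: real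
    using sum_squares_bound[of a b] sum_squares_bound[of a "-b"] by (auto simp: abs_if intro: order_trans[rotated])
  then show "AE w in M. norm (f w * g w) \<le> norm ((f w)\<^sup>2 + (g w)\<^sup>2)"
    by (intro AE_I2) (metis abs_of_nonneg add_nonneg_nonneg real_norm_def zero_le_power2)
qed measurable

locale gaussian_field = prob_space M for M :: "'w measure" +
  fixes F :: "'w \<Rightarrow> 'v::real_normed_vector \<Rightarrow> real"
  assumes gaussian: "centred_gaussian_field M F"
begin

text \<open>The definition sums over sets of points, whereas the indexed points \<open>p i\<close>
  may coincide; coefficients of equal points are collected first.\<close>

lemma gaussian_combination:
  assumes "finite T"
  shows "centred_gaussian_rv M (\<lambda>w. \<Sum>i\<in>T. b i * F w (p i))"
proof -
  have "(\<Sum>i\<in>T. b i * F w (p i)) = (\<Sum>x\<in>p ` T. (\<Sum>i | i \<in> T \<and> p i = x. b i) * F w x)" for w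
    by (subst sum.image_gen[OF assms, of _ p]) (auto simp: sum_distrib_right intro!: sum.cong)
  then show ?thesis using gaussian assms by (simp add: centred_gaussian_field_def)
qed

lemma measurable_field [measurable]: "(\<lambda>w. F w x) \<in> borel_measurable M"
  using gaussian_combination[of "{x}" "\<lambda>_. 1" id] by (simp add: centred_gaussian_rv_def)

lemma combination_square_integrable:
  "finite T \<Longrightarrow> integrable M (\<lambda>w. (\<Sum>i\<in>T. b i * F w (p i))\<^sup>2)"
  by (intro centred_gaussian_rv_square_integrable gaussian_combination)

lemma field_mult_integrable: "integrable M (\<lambda>w. F w x * F w y)"
  using combination_square_integrable[of "{x}" "\<lambda>_. 1" id] combination_square_integrable[of "{y}" "\<lambda>_. 1" id]
  by (intro integrable_mult_of_squares) auto

lemma combination_covariance: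
  assumes "finite S" "finite T"
  shows "(LINT w|M. (\<Sum>i\<in>S. a i * F w (p i)) * (\<Sum>j\<in>T. b j * F w (q j))) =
    (\<Sum>i\<in>S. \<Sum>j\<in>T. a i * b j * covariance M F (p i) (q j))"
proof -
  have "(LINT w|M. (\<Sum>i\<in>S. a i * F w (p i)) * (\<Sum>j\<in>T. b j * F w (q j))) =
    (LINT w|M. (\<Sum>i\<in>S. \<Sum>j\<in>T. a i * b j * (F w (p i) * F w (q j))))"
    by (simp add: sum_product mult_ac)
  also have "\<dots> = (\<Sum>i\<in>S. \<Sum>j\<in>T. a i * b j * covariance M F (p i) (q j))"
    unfolding covariance_def
    by (simp add: Bochner_Integration.integral_sum field_mult_integrable)
  finally show ?thesis .
qed

lemma combination_char:
  assumes "finite T"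
  shows "(CLINT w|M. iexp (\<Sum>i\<in>T. b i * F w (p i))) =
    complex_of_real (exp (- (\<Sum>i\<in>T. \<Sum>j\<in>T. b i * b j * covariance M F (p i) (p j)) / 2))"
  using centred_gaussian_rv_char[OF gaussian_combination[OF assms]] combination_covariance[OF assms assms]
  by (simp add: power2_eq_square)

end

lemma std_normal_tail_pos: "measure std_normal_distribution {t..} > 0"
proof -
  interpret real_distribution std_normal_distribution by (rule real_dist_normal_dist)
  have "{t..} \<notin> null_sets std_normal_distribution"
  proof
    assume "{t..} \<in> null_sets std_normal_distribution"
    then have "AE x in lborel. x \<in> {t..} \<longrightarrow> ennreal (std_normal_density x) = 0"
      by (subst (asm) null_sets_density_iff) auto
    then have "AE x in lborel. x \<notin> {t..}"
    proof eventually_elim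
      case (elim x)
      then show ?case using normal_density_pos[of 1 0 x] by (auto simp: ennreal_eq_0_iff)
    qed
    then have "{t..} \<in> null_sets lborel" by (simp add: AE_iff_null_sets)
    then have "emeasure lborel {t..t+1} = 0"
      using null_sets_subset[of "{t..}" lborel "{t..t+1}"] by auto
    then show False by simp
  qed
  then show ?thesis
    by (simp add: null_sets_def emeasure_eq_measure zero_less_measure_iff)
qed

text \<open>
  Conditioning on the linear combination \<open>Z\<close> of field values: the field has the same finite
  dimensional distributions as \<open>G x + \<xi> E[Z F x] / \<sigma>\<close> with \<open>G x = F x - Z E[Z F x] / \<sigma>\<^sup>2\<close> and a
  standard normal \<open>\<xi>\<close> independent of \<open>G\<close>. On the event that \<open>\<xi>\<close> is large compared to a bound of
  \<open>G\<close>, the field has the signs of \<open>E[Z F x]\<close>. No factor depends on the translation \<open>z\<close>.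
\<close>

lemma (in gaussian_field) uniformly_positive_probability:
  fixes d :: "nat \<Rightarrow> 'v" and s :: "nat \<Rightarrow> real"
  assumes stat: "\<And>x y. covariance M F x y = K (x - y)"
    and K: "\<And>x. \<bar>K x\<bar> \<le> 1"
    and bounded: "AE w in M. \<exists>L. \<forall>i. \<bar>F w (d i)\<bar> \<le> L"
    and "finite Y" and s: "\<And>i. \<bar>s i\<bar> = 1"
    and sign: "\<And>i. s i * (\<Sum>y\<in>Y. c y * K (d i - y)) \<ge> 1"
  shows "\<exists>q>0. \<forall>z. q \<le> prob {w \<in> space M. \<forall>i. s i * F w (d i + z) \<ge> 1}"
proof -
  define Z where "Z w = (\<Sum>y\<in>Y. c y * F w y)" for w
  define h where "h i = (\<Sum>y\<in>Y. c y * K (d i - y))" for i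
  have [measurable]: "Z \<in> borel_measurable M" unfolding Z_def by measurable
  have Z2: "integrable M (\<lambda>w. (Z w)\<^sup>2)"
    using combination_square_integrable[OF \<open>finite Y\<close>, of c id] by (simp add: Z_def)
  have hZ: "(LINT w|M. (\<Sum>i\<in>T. b i * F w (d i)) * Z w) = (\<Sum>i\<in>T. b i * h i)" if "finite T" for T b
    using combination_covariance[OF that \<open>finite Y\<close>, of b d c id]
    by (simp add: Z_def h_def stat sum_distrib_left mult_ac)
  define \<sigma> where "\<sigma> = sqrt (LINT w|M. (Z w)\<^sup>2)"
  have \<sigma>2: "\<sigma>\<^sup>2 = (LINT w|M. (Z w)\<^sup>2)" by (simp add: \<sigma>_def)
  \<comment> \<open>If \<open>Z\<close> vanished almost surely, its covariance with
    \<open>F w (d 0)\<close> would be 0, while the sign condition makes it at least 1 in absolute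
    value.\<close>
  have "(LINT w|M. (Z w)\<^sup>2) \<noteq> 0"
  proof
    assume "(LINT w|M. (Z w)\<^sup>2) = 0"
    then have "AE w in M. Z w = 0"
      using integral_nonneg_eq_0_iff_AE[OF Z2] by simp
    then have "(LINT w|M. (\<Sum>i\<in>{0}. 1 * F w (d i)) * Z w) = (LINT w|M. 0)"
      by (intro integral_cong_AE) auto
    then have "h 0 = 0" using hZ[of "{0}" "\<lambda>_. 1"] by simp
    then show False using sign[of 0] by (simp add: h_def)
  qed
  then have \<sigma>: "\<sigma> > 0" by (simp add: \<sigma>_def order_less_le)
  define G where "G i w = F w (d i) - Z w * h i / \<sigma>\<^sup>2" for i w
  have [measurable]: "G i \<in> borel_measurable M" for i unfolding G_def by measurable
  let ?N = "std_normal_distribution"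
  interpret N: real_distribution ?N by (rule real_dist_normal_dist)
  interpret P: pair_prob_space M ?N ..
  let ?P = "M \<Otimes>\<^sub>M ?N"
  define X where "X i v = G i (fst v) + snd v * h i / \<sigma>" for i v
  have X[measurable]: "X i \<in> borel_measurable ?P" for i unfolding X_def by measurable
  have char_X: "(CLINT v|?P. iexp (\<Sum>i\<in>T. b i * X i v)) =
      complex_of_real (exp (- (\<Sum>i\<in>T. \<Sum>j\<in>T. b i * b j * K (d i - d j)) / 2))" if T: "finite T" for T b
  proof -
    define \<beta> where "\<beta> = (\<Sum>i\<in>T. b i * h i)"
    define \<gamma> where "\<gamma> = \<beta> / \<sigma>\<^sup>2"
    define A where "A w = (\<Sum>i\<in>T. b i * F w (d i))" for w
    define U where "U w = A w - \<gamma> * Z w" for w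
    have [measurable]: "A \<in> borel_measurable M" "U \<in> borel_measurable M"
      unfolding A_def U_def by measurable
    have "(\<Sum>i\<in>T. b i * X i v) = U (fst v) + (\<beta> / \<sigma>) * snd v" for v
      by (simp add: X_def G_def U_def A_def \<gamma>_def \<beta>_def algebra_simps sum.distrib sum_subtractf
          sum_distrib_left sum_distrib_right sum_divide_distrib)
    then have "(CLINT v|?P. iexp (\<Sum>i\<in>T. b i * X i v)) =
        (CLINT v|?P. iexp (U (fst v)) * iexp ((\<beta> / \<sigma>) * snd v))"
      by (simp add: distrib_left exp_add)
    also have "\<dots> = (CLINT w|M. CLINT r|?N. iexp (U (fst (w, r))) * iexp ((\<beta> / \<sigma>) * snd (w, r)))"
      by (rule P.integral_fst'[symmetric], rule P.P.integrable_const_bound[of _ 1]) (auto simp: norm_mult)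
    also have "\<dots> = (CLINT w|M. iexp (U w) * char ?N (\<beta> / \<sigma>))"
      by (simp add: char_def)
    also have "\<dots> = (CLINT w|M. iexp (U w)) * char ?N (\<beta> / \<sigma>)" by simp
    also have "(CLINT w|M. iexp (U w)) = complex_of_real (exp (- (LINT w|M. (U w)\<^sup>2) / 2))"
    proof -
      \<comment> \<open>The disjoint sum keeps both families of points apart even when some
        \<open>d i\<close> lies in \<open>Y\<close>; the residual is thus seen to be a combination
        of field values, hence Gaussian.\<close>
      have "U w = (\<Sum>k\<in>T <+> Y. case_sum b (\<lambda>y. - \<gamma> * c y) k * F w (case_sum d id k))" for w
        using T \<open>finite Y\<close>
        by (simp add: sum.Plus U_def A_def Z_def sum_distrib_left sum_negf mult.assoc)
      then have "centred_gaussian_rv M U"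
        using gaussian_combination[of "T <+> Y" "case_sum b (\<lambda>y. - \<gamma> * c y)" "case_sum d id"]
          T \<open>finite Y\<close> by (metis (no_types, lifting) ext finite_Plus)
      then show ?thesis by (rule centred_gaussian_rv_char)
    qed
    \<comment> \<open>Pythagoras: removing the projection onto \<open>Z\<close> lowers the variance
      by \<open>(\<beta> / \<sigma>)\<^sup>2\<close>, and the normal characteristic function at
      \<open>\<beta> / \<sigma>\<close> restores exactly this amount.\<close>
    also have "(LINT w|M. (U w)\<^sup>2) = (LINT w|M. (A w)\<^sup>2) - (\<beta> / \<sigma>)\<^sup>2"
    proof -
      have A2: "integrable M (\<lambda>w. (A w)\<^sup>2)"
        unfolding A_def by (rule combination_square_integrable[OF T])
      have AZ: "integrable M (\<lambda>w. A w * Z w)"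
        by (intro integrable_mult_of_squares A2 Z2) measurable
      have "(LINT w|M. (U w)\<^sup>2) = (LINT w|M. (A w)\<^sup>2 - 2 * \<gamma> * (A w * Z w) + \<gamma>\<^sup>2 * (Z w)\<^sup>2)"
        by (simp add: U_def power2_eq_square algebra_simps)
      also have "\<dots> = (LINT w|M. (A w)\<^sup>2) - 2 * \<gamma> * (LINT w|M. A w * Z w) + \<gamma>\<^sup>2 * (LINT w|M. (Z w)\<^sup>2)"
        using A2 AZ Z2 by simp
      also have "(LINT w|M. A w * Z w) = \<beta>"
        using hZ[OF T] by (simp add: A_def \<beta>_def)
      finally have "(LINT w|M. (U w)\<^sup>2) = (LINT w|M. (A w)\<^sup>2) - 2 * \<gamma> * \<beta> + \<gamma>\<^sup>2 * \<sigma>\<^sup>2"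
        by (simp only: \<sigma>2)
      moreover have "\<gamma> * \<beta> = (\<beta> / \<sigma>)\<^sup>2" "\<gamma>\<^sup>2 * \<sigma>\<^sup>2 = (\<beta> / \<sigma>)\<^sup>2"
        using \<sigma> by (simp_all add: \<gamma>_def power2_eq_square)
      ultimately show ?thesis by linarith
    qed
    also have "(LINT w|M. (A w)\<^sup>2) = (\<Sum>i\<in>T. \<Sum>j\<in>T. b i * b j * K (d i - d j))"
      using combination_covariance[OF T T, of b d b d] by (simp add: A_def power2_eq_square stat)
    finally show ?thesis
      by (simp add: char_std_normal_distribution flip: of_real_mult exp_add)
         (simp add: field_simps)
  qed
  let ?E = "\<lambda>i. {r::real. s i * r \<ge> 1}"
  have E: "?E i \<in> sets borel" for i by measurable
  \<comment> \<open>The shift \<open>z\<close> cancels in every covariance, so the shifted field and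
    the model \<open>X\<close> have equal finite dimensional laws. This makes the final bound
    uniform in \<open>z\<close>.\<close>
  have eq: "prob {w \<in> space M. \<forall>i. s i * F w (d i + z) \<ge> 1} = P.P.prob {v \<in> space ?P. \<forall>i. s i * X i v \<ge> 1}" for z
  proof -
    have "prob {w \<in> space M. \<forall>i. F w (d i + z) \<in> ?E i} = P.P.prob {v \<in> space ?P. \<forall>i. X i v \<in> ?E i}"
    proof (rule prob_all_eq[OF prob_space_axioms P.P.prob_space_axioms _ X _ E])
      show "(CLINT w|M. iexp (\<Sum>i\<in>T. b i * F w (d i + z))) = (CLINT v|?P. iexp (\<Sum>i\<in>T. b i * X i v))"
        if "finite T" for T b
        unfolding char_X[OF that] combination_char[OF that, of b "\<lambda>i. d i + z"] by (simp add: stat)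
    qed measurable
    then show ?thesis by simp
  qed
  have "AE w in M. \<exists>n::nat. \<forall>i. \<bar>G i w\<bar> \<le> real n"
    using bounded
  proof (rule AE_mp, intro AE_I2 impI)
    fix w assume "\<exists>L. \<forall>i. \<bar>F w (d i)\<bar> \<le> L"
    then obtain L where L: "\<And>i. \<bar>F w (d i)\<bar> \<le> L" by blast
    define H where "H = (\<Sum>y\<in>Y. \<bar>c y\<bar>)"
    have h: "\<bar>h i\<bar> \<le> H" for i
    proof -
      have "\<bar>h i\<bar> \<le> (\<Sum>y\<in>Y. \<bar>c y * K (d i - y)\<bar>)" unfolding h_def by (rule sum_abs)
      also have "\<dots> \<le> H" unfolding H_def
        by (intro sum_mono) (use K in \<open>auto simp: abs_mult mult_left_le\<close>)
      finally show ?thesis .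
    qed
    obtain n :: nat where n: "L + \<bar>Z w\<bar> * H / \<sigma>\<^sup>2 \<le> real n" using real_arch_simple by blast
    have "\<bar>G i w\<bar> \<le> real n" for i
    proof -
      have "\<bar>G i w\<bar> \<le> \<bar>F w (d i)\<bar> + \<bar>Z w * h i / \<sigma>\<^sup>2\<bar>" unfolding G_def by (rule abs_triangle_ineq4)
      also have "\<bar>Z w * h i / \<sigma>\<^sup>2\<bar> = \<bar>Z w\<bar> * \<bar>h i\<bar> / \<sigma>\<^sup>2" by (simp add: abs_mult)
      also have "\<dots> \<le> \<bar>Z w\<bar> * H / \<sigma>\<^sup>2"
        using h by (intro divide_right_mono mult_left_mono) auto
      finally show ?thesis using L[of i] n by linarith
    qed
    then show "\<exists>n::nat. \<forall>i. \<bar>G i w\<bar> \<le> real n" by blast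
  qed
  define C where "C n = {w \<in> space M. \<forall>i. \<bar>G i w\<bar> \<le> real n}" for n
  have [measurable]: "C n \<in> events" for n unfolding C_def by measurable
  have "\<exists>n. prob (C n) > 0"
  proof (rule ccontr)
    assume "\<not> ?thesis"
    then have "C n \<in> null_sets M" for n
      by (simp add: null_sets_def emeasure_eq_measure measure_le_0_iff not_less)
    then have "(\<Union>n. C n) \<in> null_sets M" by (rule null_sets_UN)
    then have "AE w in M. w \<notin> (\<Union>n. C n)" by (rule AE_not_in)
    with AE_space \<open>AE w in M. \<exists>n::nat. \<forall>i. \<bar>G i w\<bar> \<le> real n\<close> have "AE w in M. False"
      by eventually_elim (auto simp: C_def)
    then show False by simp
  qed
  then obtain n where n: "prob (C n) > 0" by blast
  \<comment> \<open>On \<open>C n\<close> the residual is at most \<open>n\<close> in absolute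
    value. As \<open>s i * h i \<ge> 1\<close>, a normal variable of at least \<open>t\<close>
    contributes at least \<open>n + 1\<close>, which leaves the margin 1.\<close>
  define t where "t = \<sigma> * (real n + 1)"
  have "C n \<times> {t..} \<subseteq> {v \<in> space ?P. \<forall>i. s i * X i v \<ge> 1}"
  proof (intro subsetI CollectI conjI allI)
    fix v i assume v: "v \<in> C n \<times> {t..}"
    then show "v \<in> space ?P" by (auto simp: C_def space_pair_measure)
    have "\<bar>s i * G i (fst v)\<bar> \<le> real n" using v s[of i] by (auto simp: C_def abs_mult)
    moreover have "(real n + 1) * 1 \<le> (snd v / \<sigma>) * (s i * h i)"
    proof (intro mult_mono)
      show "real n + 1 \<le> snd v / \<sigma>" using v \<sigma> by (auto simp: t_def field_simps)
      then show "0 \<le> snd v / \<sigma>" by linarith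
    qed (use sign[of i] in \<open>auto simp: h_def\<close>)
    ultimately show "1 \<le> s i * X i v" by (simp add: X_def algebra_simps abs_le_iff)
  qed
  moreover have "{v \<in> space ?P. \<forall>i. s i * X i v \<ge> 1} \<in> sets ?P" by measurable
  ultimately have "P.P.prob (C n \<times> {t..}) \<le> P.P.prob {v \<in> space ?P. \<forall>i. s i * X i v \<ge> 1}"
    by (rule P.P.finite_measure_mono)
  moreover have "P.P.prob (C n \<times> {t..}) = prob (C n) * measure ?N {t..}"
    by (simp add: measure_def N.emeasure_pair_measure_Times enn2real_mult)
  ultimately show ?thesis
    using n std_normal_tail_pos[of t] eq
    by (intro exI[of _ "prob (C n) * measure ?N {t..}"]) auto
qed

section \<open>Nodal domains\<close>

text \<open>The component of \<open>z\<close> contains the closed ball, which is connected and free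
  of zeros. If it left the outer ball it would meet the sphere, and \<open>f\<close> would take both
  signs on a connected set without zeros.\<close>

lemma nodal_domain_between_balls:
  fixes f :: "real^'n \<Rightarrow> real"
  assumes cont: "continuous_on UNIV f" and "0 < a" "a < b"
    and pos: "\<And>x. x \<in> cball z a \<Longrightarrow> f x > 0" and neg: "\<And>x. x \<in> sphere z b \<Longrightarrow> f x < 0"
  obtains \<omega> where "\<omega> \<in> nodal_domains f" "cball z a \<subseteq> \<omega>" "\<omega> \<subseteq> ball z b"
proof
  let ?S = "{x. f x \<noteq> 0}"
  let ?\<omega> = "connected_component_set ?S z"
  have z: "z \<in> cball z a" using assms(2) by simp
  show "?\<omega> \<in> nodal_domains f"
    using pos[OF z] by (auto simp: nodal_domains_def intro!: componentsI)
  show sub: "cball z a \<subseteq> ?\<omega>"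
  proof (intro connected_component_maximal z subsetI CollectI)
    show "f x \<noteq> 0" if "x \<in> cball z a" for x using pos[OF that] by simp
  qed simp
  have conn: "connected ?\<omega>" by (rule connected_connected_component)
  show "?\<omega> \<subseteq> ball z b"
  proof (rule ccontr)
    assume "\<not> ?\<omega> \<subseteq> ball z b"
    moreover have "z \<in> ?\<omega> \<inter> ball z b" using subsetD[OF sub z] assms(2,3) by simp
    ultimately have "?\<omega> \<inter> frontier (ball z b) \<noteq> {}"
      using conn by (intro connected_Int_frontier) blast+
    moreover have "frontier (ball z b) = sphere z b" using assms(2,3) by (intro frontier_ball) simp
    ultimately obtain y where y: "y \<in> ?\<omega>" "y \<in> sphere z b" by blast
    have "f y < 0" by (rule neg[OF y(2)])
    have "connected (f ` ?\<omega>)"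
      using cont conn by (intro connected_continuous_image) (auto intro: continuous_on_subset)
    moreover have "f y \<in> f ` ?\<omega>" "f z \<in> f ` ?\<omega>" by (rule imageI[OF y(1)], rule imageI[OF subsetD[OF sub z]])
    ultimately have "{f y..f z} \<subseteq> f ` ?\<omega>" by (rule connected_contains_Icc)
    then have "0 \<in> f ` ?\<omega>" using \<open>f y < 0\<close> pos[OF z] by auto
    then show False using connected_component_subset[of ?S z] by auto
  qed
qed

lemma nodal_count_0:
  fixes f :: "real^'n \<Rightarrow> real"
  assumes "continuous_on UNIV f"
  shows "nodal_count f 0 R = 0"
proof -
  have "emeasure lborel \<omega> > 0" if "\<omega> \<in> nodal_domains f" for \<omega>
  proof -
    have "open {x. f x \<noteq> 0}"
      using assms by (intro open_Collect_neq) auto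
    then have "open \<omega>" using that by (auto simp: nodal_domains_def intro: open_components)
    moreover have "\<omega> \<noteq> {}" using that by (auto simp: nodal_domains_def dest: in_components_nonempty)
    ultimately obtain x e where e: "e > 0" "ball x e \<subseteq> \<omega>" by (meson all_not_in_conv openE)
    have "0 < emeasure lborel (ball x e)" using e(1) by (simp add: emeasure_ball)
    also have "\<dots> \<le> emeasure lborel \<omega>" using e \<open>open \<omega>\<close> by (intro emeasure_mono) auto
    finally show ?thesis .
  qed
  then have "{\<omega> \<in> nodal_domains f. \<omega> \<subseteq> ball 0 R \<and> emeasure lborel \<omega> \<le> 0} = {}"
    by (force simp: not_less)
  then show ?thesis by (simp only: nodal_count_def emeasure_empty)
qed

text \<open>Each centre yields a domain of volume above \<open>s\<close> and at most
  \<open>t\<close>, counted at level \<open>t\<close> but not at level \<open>s\<close>; disjoint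
  balls keep these domains distinct. The inequality is additive because both counts may be
  infinite.\<close>

lemma nodal_count_gap:
  fixes f :: "real^'n \<Rightarrow> real"
  assumes cont: "continuous_on UNIV f" and ab: "0 < a" "a < b" and "finite X" "s \<le> t"
    and vol: "s < emeasure lborel (ball (0::real^'n) a)" "emeasure lborel (ball (0::real^'n) b) \<le> t"
    and inside: "\<And>x. x \<in> X \<Longrightarrow> ball x b \<subseteq> ball 0 R"
    and disj: "\<And>x y. x \<in> X \<Longrightarrow> y \<in> X \<Longrightarrow> x \<noteq> y \<Longrightarrow> ball x b \<inter> ball y b = {}"
    and sign: "\<And>x y. x \<in> X \<Longrightarrow> y \<in> cball x a \<Longrightarrow> f y > 0" "\<And>x y. x \<in> X \<Longrightarrow> y \<in> sphere x b \<Longrightarrow> f y < 0"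
  shows "nodal_count f s R + of_nat (card X) \<le> nodal_count f t R"
proof -
  have "\<exists>\<omega>. \<omega> \<in> nodal_domains f \<and> cball x a \<subseteq> \<omega> \<and> \<omega> \<subseteq> ball x b" if "x \<in> X" for x
    using nodal_domain_between_balls[OF cont ab] sign that by metis
  then obtain \<omega> where \<omega>: "\<And>x. x \<in> X \<Longrightarrow> \<omega> x \<in> nodal_domains f"
    "\<And>x. x \<in> X \<Longrightarrow> cball x a \<subseteq> \<omega> x" "\<And>x. x \<in> X \<Longrightarrow> \<omega> x \<subseteq> ball x b" by metis
  let ?A = "\<lambda>s. {\<omega> \<in> nodal_domains f. \<omega> \<subseteq> ball 0 R \<and> emeasure lborel \<omega> \<le> s}"
  have ball_vol: "emeasure lborel (ball x r) = emeasure lborel (ball (0::real^'n) r)" if "r > 0" for x :: "real^'n" and r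
    using that by (simp add: emeasure_ball)
  have "open (\<omega> x)" if "x \<in> X" for x
    using \<omega>(1)[OF that] cont
    by (auto simp: nodal_domains_def intro!: open_components[of "{x. f x \<noteq> 0}"] open_Collect_neq)
  then have large: "s < emeasure lborel (\<omega> x)" if "x \<in> X" for x
    using vol(1) ball_vol[OF ab(1), of x] emeasure_mono[of "ball x a" "\<omega> x" lborel] \<omega>(2)[OF that]
      ball_subset_cball[of x a] that by (force intro: less_le_trans)
  have small: "emeasure lborel (\<omega> x) \<le> t" if "x \<in> X" for x
    using emeasure_mono[OF \<omega>(3)[OF that], of lborel] ball_vol[of b x] ab vol(2) by (auto intro: order_trans)
  have "inj_on \<omega> X"
  proof (rule inj_onI, rule ccontr)
    fix x y assume xy: "x \<in> X" "y \<in> X" "\<omega> x = \<omega> y" "x \<noteq> y"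
    have "x \<in> ball x b \<inter> ball y b"
      using \<omega>(2,3)[OF xy(1)] \<omega>(3)[OF xy(2)] xy(3) ab by (auto simp: subset_iff)
    then show False using disj[OF xy(1,2,4)] by blast
  qed
  have "nodal_count f s R + of_nat (card X) =
      emeasure (count_space UNIV) (?A s) + emeasure (count_space UNIV) (\<omega> ` X)"
    using \<open>finite X\<close> \<open>inj_on \<omega> X\<close> by (simp add: nodal_count_def card_image)
  also have "\<dots> = emeasure (count_space UNIV) (?A s \<union> \<omega> ` X)"
  proof (intro plus_emeasure)
    have "\<omega> x \<notin> ?A s" if "x \<in> X" for x using large[OF that] by (simp add: not_le)
    then show "?A s \<inter> \<omega> ` X = {}" by blast
  qed simp_all
  also have "\<dots> \<le> emeasure (count_space UNIV) (?A t)"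
  proof (intro emeasure_mono Un_least subsetI)
    fix u assume "u \<in> ?A s"
    then show "u \<in> ?A t" using \<open>s \<le> t\<close> by auto
  next
    fix u assume "u \<in> \<omega> ` X"
    then show "u \<in> ?A t" using \<omega> inside small by (auto simp: subset_iff)
  qed simp
  finally show ?thesis by (simp add: nodal_count_def)
qed

lemma ball_packing:
  assumes "b > 0"
  shows "\<exists>k>0. \<forall>\<^sub>F R in at_top. \<exists>X::(real^'n) set. finite X \<and> (\<forall>x\<in>X. ball x b \<subseteq> ball 0 R) \<and>
    (\<forall>x\<in>X. \<forall>y\<in>X. x \<noteq> y \<longrightarrow> ball x b \<inter> ball y b = {}) \<and> k * R ^ CARD('n) \<le> real (card X)"
proof -
  define n where "n = real CARD('n)"
  have n: "n \<ge> 1" by (simp add: n_def Suc_le_eq)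
  show ?thesis
  proof (intro exI[of _ "(1 / (8 * b * n)) ^ CARD('n)"] conjI)
    show "(1 / (8 * b * n)) ^ CARD('n) > 0" using assms n by simp
    show "\<forall>\<^sub>F R in at_top. \<exists>X::(real^'n) set. finite X \<and> (\<forall>x\<in>X. ball x b \<subseteq> ball 0 R) \<and>
      (\<forall>x\<in>X. \<forall>y\<in>X. x \<noteq> y \<longrightarrow> ball x b \<inter> ball y b = {}) \<and>
      (1 / (8 * b * n)) ^ CARD('n) * R ^ CARD('n) \<le> real (card X)"
      using eventually_ge_at_top[of "8 * b * n"]
    proof eventually_elim
      case (elim R)
      \<comment> \<open>The centres form a grid of spacing \<open>2 * b\<close> in the nonnegative
        orthant, with \<open>N\<close> points per axis. The divisor \<open>4 * b * n\<close> bounds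
        their l1 norm by \<open>R / 2\<close>, and the remaining \<open>R / 2\<close> accommodates
        the radius \<open>b\<close>.\<close>
      define N where "N = nat \<lfloor>R / (4 * b * n)\<rfloor>"
      have bn: "b * n > 0" "b * n \<ge> b" using assms n by (auto simp: mult_le_cancel_left1)
      have q: "R / (4 * b * n) \<ge> 2" using elim bn by (simp add: field_simps)
      have N: "real N \<le> R / (4 * b * n)" "R / (4 * b * n) - 1 \<le> real N"
        using q unfolding N_def by linarith+
      define p :: "('n \<Rightarrow> nat) \<Rightarrow> real^'n" where "p g = (\<chi> i. 2 * b * real (g i))" for g
      define G where "G = (\<Pi>\<^sub>E i\<in>(UNIV::'n set). {..<N})"
      have "finite G" unfolding G_def by (intro finite_PiE) auto
      have "inj_on p G"
        using assms by (auto simp: inj_on_def p_def vec_eq_iff)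
      have "ball x b \<subseteq> ball 0 R" if "x \<in> p ` G" for x
      proof -
        obtain g where g: "g \<in> G" "x = p g" using \<open>x \<in> p ` G\<close> by blast
        have "norm x \<le> (\<Sum>i\<in>UNIV. \<bar>x $ i\<bar>)" by (rule norm_le_l1_cart)
        also have "\<dots> \<le> (\<Sum>i\<in>(UNIV::'n set). 2 * b * real N)"
          using g assms by (intro sum_mono) (auto simp: p_def G_def PiE_iff less_imp_le)
        also have "\<dots> = 2 * (b * n) * real N" by (simp add: n_def)
        also have "\<dots> \<le> 2 * (b * n) * (R / (4 * b * n))"
          using N(1) bn by (intro mult_left_mono) auto
        also have "\<dots> = R / 2" using assms n by (simp add: field_simps)
        finally have "norm x \<le> R / 2" .
        moreover have "b \<le> R / 2" using elim bn by linarith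
        ultimately show ?thesis by (simp add: ball_subset_ball_iff)
      qed
      moreover have "ball x b \<inter> ball y b = {}" if xy: "x \<in> p ` G" "y \<in> p ` G" "x \<noteq> y" for x y
      proof -
        obtain g h where gh: "x = p g" "y = p h" using xy by blast
        then obtain i where "g i \<noteq> h i" using xy(3) by (metis ext)
        then have "1 \<le> \<bar>real (g i) - real (h i)\<bar>" by linarith
        then have "2 * b * 1 \<le> 2 * b * \<bar>real (g i) - real (h i)\<bar>"
          using assms by (intro mult_left_mono) auto
        also have "\<dots> = \<bar>(x - y) $ i\<bar>"
          using assms by (simp add: gh p_def abs_mult flip: right_diff_distrib)
        also have "\<dots> \<le> dist x y" using component_le_norm_cart[of "x - y" i] by (simp add: dist_norm)
        finally show ?thesis using assms by (intro disjoint_ballI) auto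
      qed
      moreover have "(1 / (8 * b * n)) ^ CARD('n) * R ^ CARD('n) \<le> real (card (p ` G))"
      proof -
        \<comment> \<open>Rounding down costs at most 1, hence at most half, the quotient being at
          least 2; this turns the 4 into the 8 of the constant.\<close>
        have half: "x / 2 \<le> y" if "x - 1 \<le> y" "2 \<le> x" for x y :: real using that by linarith
        have "R / (8 * b * n) = (R / (4 * b * n)) / 2" by simp
        then have "R / (8 * b * n) \<le> real N" using half[OF N(2) q] by (simp only:)
        moreover have "0 \<le> R / (8 * b * n)" using elim bn by (auto intro!: divide_nonneg_nonneg)
        ultimately have "(R / (8 * b * n)) ^ CARD('n) \<le> real N ^ CARD('n)" by (rule power_mono)
        moreover have "card (p ` G) = N ^ CARD('n)"
          using \<open>inj_on p G\<close> by (simp add: card_image G_def card_PiE)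
        ultimately show ?thesis by (simp add: power_divide)
      qed
      ultimately show ?case using \<open>finite G\<close> by (intro exI[of _ "p ` G"]) auto
    qed
  qed
qed

section \<open>Comparison of limits in mean\<close>

lemma ennreal_abs_diff_bounds:
  fixes x :: ennreal
  assumes "0 \<le> l"
  shows "ennreal l \<le> x + e2ennreal \<bar>enn2ereal x - ereal l\<bar>"
    and "x \<le> ennreal l + e2ennreal \<bar>enn2ereal x - ereal l\<bar>"
proof -
  have "ennreal l \<le> x + e2ennreal \<bar>enn2ereal x - ereal l\<bar> \<and> x \<le> ennreal l + e2ennreal \<bar>enn2ereal x - ereal l\<bar>"
  proof (cases x)
    case (real r)
    then show ?thesis using assms
      by (simp add: enn2ereal_ennreal e2ennreal_ereal flip: ennreal_plus) (auto intro!: ennreal_leI)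
  next
    case top
    then show ?thesis by (simp add: top_ennreal.rep_eq)
  qed
  then show "ennreal l \<le> x + e2ennreal \<bar>enn2ereal x - ereal l\<bar>"
    "x \<le> ennreal l + e2ennreal \<bar>enn2ereal x - ereal l\<bar>" by auto
qed

context prob_space
begin

lemma emeasure_completion_space: "emeasure (completion M) (space M) = 1"
  by (simp add: emeasure_space_1)

text \<open>The definition admits any real \<open>l\<close>; were it negative, the distance to it
  would be at least \<open>- l\<close> at every sample point.\<close>

lemma tendsto_in_mean_nonneg:
  assumes "tendsto_in_mean M X l"
  shows "0 \<le> l"
proof (rule ccontr)
  assume "\<not> 0 \<le> l"
  then have l: "- l > 0" by simp
  have "ennreal (- l) \<le> e2ennreal \<bar>enn2ereal x - ereal l\<bar>" for x
  proof (cases x)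
    case (real r)
    then show ?thesis using l by (simp add: enn2ereal_ennreal e2ennreal_ereal ennreal_leI)
  next
    case top
    then show ?thesis by (simp add: top_ennreal.rep_eq)
  qed
  then have "(\<integral>\<^sup>+w. ennreal (- l) \<partial>completion M) \<le> (\<integral>\<^sup>+w. e2ennreal \<bar>enn2ereal (X R w) - ereal l\<bar> \<partial>completion M)" for R
    by (intro nn_integral_mono) auto
  then have "ennreal (- l) \<le> (\<integral>\<^sup>+w. e2ennreal \<bar>enn2ereal (X R w) - ereal l\<bar> \<partial>completion M)" for R
    by (simp add: emeasure_completion_space)
  then have "ennreal (- l) \<le> 0"
    using assms unfolding tendsto_in_mean_def by (intro tendsto_lowerbound[of _ 0 at_top]) auto
  then show False using l by simp
qed

text \<open>Take expectations: up to the error of \<open>X\<close>, \<open>l + \<delta>\<close> is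
  at most the mean of \<open>X + D\<close>, which is at most \<open>m\<close> up to the error of
  \<open>Y\<close>. Errors are added on the larger side and nothing is subtracted, since the
  variables may be infinite.\<close>

lemma tendsto_in_mean_gap:
  assumes X: "tendsto_in_mean M X l" and Y: "tendsto_in_mean M Y m"
    and D: "\<forall>\<^sub>F R in at_top. \<exists>D \<in> borel_measurable M.
      (AE w in M. X R w + D w \<le> Y R w) \<and> \<delta> \<le> (\<integral>\<^sup>+w. D w \<partial>M)"
  shows "ennreal l + \<delta> \<le> ennreal m"
proof -
  define errX where "errX R w = e2ennreal \<bar>enn2ereal (X R w) - ereal l\<bar>" for R w
  define errY where "errY R w = e2ennreal \<bar>enn2ereal (Y R w) - ereal m\<bar>" for R w
  have l: "0 \<le> l" and m: "0 \<le> m" using tendsto_in_mean_nonneg X Y by auto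
  have "((\<lambda>R. (\<integral>\<^sup>+w. errX R w \<partial>completion M)) \<longlongrightarrow> 0) at_top" "((\<lambda>R. (\<integral>\<^sup>+w. errY R w \<partial>completion M)) \<longlongrightarrow> 0) at_top"
    using X Y by (auto simp: tendsto_in_mean_def errX_def errY_def)
  then have lim: "((\<lambda>R. ennreal m + (\<integral>\<^sup>+w. errY R w \<partial>completion M) + (\<integral>\<^sup>+w. errX R w \<partial>completion M)) \<longlongrightarrow> ennreal m + 0 + 0) at_top"
    by (intro tendsto_add tendsto_const)
  have "\<forall>\<^sub>F R in at_top. X R \<in> borel_measurable (completion M)" "\<forall>\<^sub>F R in at_top. Y R \<in> borel_measurable (completion M)"
    using X Y by (auto simp: tendsto_in_mean_def)
  with D have "\<forall>\<^sub>F R in at_top. ennreal l + \<delta> \<le> ennreal m + (\<integral>\<^sup>+w. errY R w \<partial>completion M) + (\<integral>\<^sup>+w. errX R w \<partial>completion M)"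
  proof eventually_elim
    case (elim R)
    note [measurable] = elim(2,3)
    obtain D where D0: "D \<in> borel_measurable M" "AE w in M. X R w + D w \<le> Y R w" "\<delta> \<le> (\<integral>\<^sup>+w. D w \<partial>M)"
      using elim(1) by blast
    have [measurable]: "D \<in> borel_measurable (completion M)" by (rule measurable_completion[OF D0(1)])
    have [measurable]: "errX R \<in> borel_measurable (completion M)" "errY R \<in> borel_measurable (completion M)"
      unfolding errX_def errY_def by measurable
    have "ennreal l = (\<integral>\<^sup>+w. ennreal l \<partial>completion M)" by (simp add: emeasure_completion_space)
    also have "\<dots> \<le> (\<integral>\<^sup>+w. X R w + errX R w \<partial>completion M)"
      unfolding errX_def by (intro nn_integral_mono ennreal_abs_diff_bounds l)
    also have "\<dots> = (\<integral>\<^sup>+w. X R w \<partial>completion M) + (\<integral>\<^sup>+w. errX R w \<partial>completion M)"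
      by (rule nn_integral_add) measurable
    finally have "ennreal l + \<delta> \<le> ((\<integral>\<^sup>+w. X R w \<partial>completion M) + (\<integral>\<^sup>+w. errX R w \<partial>completion M)) + (\<integral>\<^sup>+w. D w \<partial>completion M)"
      using D0(3) by (intro add_mono) (auto simp: nn_integral_completion)
    also have "\<dots> = (\<integral>\<^sup>+w. X R w + D w \<partial>completion M) + (\<integral>\<^sup>+w. errX R w \<partial>completion M)"
      by (subst nn_integral_add) (auto simp: ac_simps)
    also have "(\<integral>\<^sup>+w. X R w + D w \<partial>completion M) \<le> (\<integral>\<^sup>+w. ennreal m + errY R w \<partial>completion M)"
    proof (rule nn_integral_mono_AE)
      have "AE w in completion M. X R w + D w \<le> Y R w" using D0(2) by (rule AE_completion)
      then show "AE w in completion M. X R w + D w \<le> ennreal m + errY R w"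
        by eventually_elim (unfold errY_def, rule order_trans[OF _ ennreal_abs_diff_bounds(2)[OF m]])
    qed
    also have "\<dots> = ennreal m + (\<integral>\<^sup>+w. errY R w \<partial>completion M)"
      by (subst nn_integral_add) (auto simp: emeasure_completion_space)
    finally show ?case by (simp add: add_right_mono)
  qed
  then have "ennreal l + \<delta> \<le> ennreal m + 0 + 0"
    by (rule tendsto_lowerbound[OF lim]) simp
  then show ?thesis by simp
qed

end

section \<open>From sign changes to a gap in the volume distribution\<close>

lemma C2_smooth_continuous: "C2_smooth f \<Longrightarrow> continuous_on UNIV f"
  unfolding C2_smooth_def
  by (metis continuous_at_imp_continuous_on has_derivative_continuous)

text \<open>
  A countable dense subset of the closed ball and of the sphere makes the event that \<open>F\<close> is positive
  on a translate of the former and negative on that of the latter measurable.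
\<close>

lemma sign_change_event:
  fixes M :: "'w measure" and F :: "'w \<Rightarrow> real^'n \<Rightarrow> real"
  assumes M: "prob_space M" and F: "centred_gaussian_field M F"
    and cont: "AE w in M. continuous_on UNIV (F w)"
    and \<rho>: "spectral_measure M F \<rho>" "rho4_star \<rho>"
    and ab: "0 < a" "a < b"
  obtains q E where "q > 0" "\<And>z. E z \<in> sets M" "\<And>z. q \<le> measure M (E z)"
    "\<And>w z y. w \<in> E z \<Longrightarrow> continuous_on UNIV (F w) \<Longrightarrow> y \<in> cball z a \<Longrightarrow> F w y > 0"
    "\<And>w z y. w \<in> E z \<Longrightarrow> continuous_on UNIV (F w) \<Longrightarrow> y \<in> sphere z b \<Longrightarrow> F w y < 0"
proof -
  interpret prob_space M by (rule M)
  interpret gaussian_field M F by unfold_locales (rule F)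
  have \<rho>_prob: "prob_space \<rho>" and \<rho>_sets: "sets \<rho> = sets borel"
    and \<rho>_cov: "\<And>x y. complex_of_real (covariance M F x y) = (CLINT l|\<rho>. iexp ((x - y) \<bullet> l))"
    using \<rho>(1) by (auto simp: spectral_measure_def)
  define K where "K z = covariance M F z 0" for z
  have K: "complex_of_real (K z) = (CLINT l|\<rho>. iexp (z \<bullet> l))" for z
    using \<rho>_cov[of z 0] by (simp add: K_def)
  have stat: "covariance M F x y = K (x - y)" for x y
    using \<rho>_cov[of x y] K[of "x - y"] by (metis of_real_eq_iff)
  interpret \<rho>: prob_space \<rho> by (rule \<rho>_prob)
  have K1: "\<bar>K z\<bar> \<le> 1" for z
  proof -
    have "\<bar>K z\<bar> = cmod (CLINT l|\<rho>. iexp (z \<bullet> l))" by (metis K norm_of_real real_norm_def)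
    also have "\<dots> \<le> (LINT l|\<rho>. cmod (iexp (z \<bullet> l)))" by (rule integral_norm_bound)
    also have "\<dots> = 1" by (simp add: \<rho>.prob_space)
    finally show ?thesis .
  qed
  have int: "interior (msupport \<rho>) \<noteq> {}" using \<rho>(2) by (simp add: rho4_star_def)
  obtain Y c where Y: "finite Y"
    "\<And>x. norm x \<le> a \<Longrightarrow> (\<Sum>y\<in>Y. c y * K (x - y)) \<ge> 1"
    "\<And>x. norm x = b \<Longrightarrow> (\<Sum>y\<in>Y. c y * K (x - y)) \<le> - 1"
    by (rule separating_combination[OF \<rho>_prob \<rho>_sets int K less_imp_le[OF ab(1)] ab(2)]) blast
  obtain D1 :: "(real^'n) set" where D1: "countable D1" "D1 \<subseteq> cball 0 a" "cball 0 a \<subseteq> closure D1"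
    by (rule separable)
  obtain D2 :: "(real^'n) set" where D2: "countable D2" "D2 \<subseteq> sphere 0 b" "sphere 0 b \<subseteq> closure D2"
    by (rule separable)
  have "D1 \<noteq> {}" using D1(3) ab(1) by force
  define d where "d = from_nat_into (D1 \<union> D2)"
  have range_d: "range d = D1 \<union> D2"
    unfolding d_def using D1(1) D2(1) \<open>D1 \<noteq> {}\<close> by (intro range_from_nat_into) auto
  have d_cases: "norm (d i) \<le> a \<or> norm (d i) = b" for i
    using range_d D1(2) D2(2) by (force simp: subset_iff)
  define s where "s i = (if norm (d i) \<le> a then 1 else - 1 :: real)" for i
  \<comment> \<open>With threshold 1 instead of 0 the condition is closed: by continuity it extends
    from the dense points to the whole ball and sphere, and it still gives strict signs
    there.\<close>
  define E where "E z = {w \<in> space M. \<forall>i. s i * F w (d i + z) \<ge> 1}" for z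
  have "\<exists>q>0. \<forall>z. q \<le> prob (E z)"
    unfolding E_def
  proof (rule uniformly_positive_probability[OF stat K1 _ Y(1)])
    show "AE w in M. \<exists>L. \<forall>i. \<bar>F w (d i)\<bar> \<le> L"
      using cont
    proof eventually_elim
      case (elim w)
      have "compact (F w ` cball 0 b)"
        using elim by (intro compact_continuous_image) (auto intro: continuous_on_subset)
      then obtain L where "\<forall>r\<in>F w ` cball 0 b. norm r \<le> L"
        using compact_imp_bounded bounded_iff by metis
      moreover have "d i \<in> cball 0 b" for i using d_cases[of i] ab by auto
      ultimately show ?case by (intro exI[of _ L]) auto
    qed
    show "\<bar>s i\<bar> = 1" for i by (simp add: s_def)
    show "s i * (\<Sum>y\<in>Y. c y * K (d i - y)) \<ge> 1" for i
      using Y(2)[of "d i"] Y(3)[of "d i"] d_cases[of i] by (auto simp: s_def)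
  qed
  then obtain q where q: "q > 0" "\<And>z. q \<le> prob (E z)" by blast
  have cont_shift: "continuous_on UNIV (\<lambda>y. F w (y + z))" if "continuous_on UNIV (F w)" for w z
    by (rule continuous_on_compose2[OF that]) (auto intro!: continuous_intros)
  show ?thesis
  proof (rule that[OF q(1) _ q(2)])
    show "E z \<in> sets M" for z unfolding E_def by measurable
  next
    fix w z y assume w: "w \<in> E z" "continuous_on UNIV (F w)" "y \<in> cball z a"
    have "closed {y. 1 \<le> F w (y + z)}"
      by (intro closed_Collect_le continuous_on_const cont_shift[OF w(2)])
    moreover have "D1 \<subseteq> {y. 1 \<le> F w (y + z)}"
    proof
      fix y assume y: "y \<in> D1"
      then obtain i where i: "y = d i" using range_d by blast
      have "norm (d i) \<le> a" using y D1(2) i by auto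
      moreover have "1 \<le> s i * F w (d i + z)" using w(1) by (auto simp: E_def)
      ultimately show "y \<in> {y. 1 \<le> F w (y + z)}" by (simp add: i s_def)
    qed
    ultimately have "closure D1 \<subseteq> {y. 1 \<le> F w (y + z)}" by (rule closure_minimal[rotated])
    moreover have "y - z \<in> cball 0 a" using w(3) by (simp add: dist_norm norm_minus_commute)
    ultimately show "F w y > 0" using D1(3) by force
  next
    fix w z y assume w: "w \<in> E z" "continuous_on UNIV (F w)" "y \<in> sphere z b"
    have "closed {y. F w (y + z) \<le> - 1}"
      by (intro closed_Collect_le continuous_on_const cont_shift[OF w(2)])
    moreover have "D2 \<subseteq> {y. F w (y + z) \<le> - 1}"
    proof
      fix y assume y: "y \<in> D2"
      then obtain i where i: "y = d i" using range_d by blast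
      have "norm (d i) = b" using y D2(2) i by auto
      moreover have "1 \<le> s i * F w (d i + z)" using w(1) by (auto simp: E_def)
      ultimately show "y \<in> {y. F w (y + z) \<le> - 1}" using ab by (simp add: i s_def)
    qed
    ultimately have "closure D2 \<subseteq> {y. F w (y + z) \<le> - 1}" by (rule closure_minimal[rotated])
    moreover have "y - z \<in> sphere 0 b" using w(3) by (simp add: dist_norm norm_minus_commute)
    ultimately show "F w y < 0" using D2(3) by force
  qed
qed

lemma nodal_volume_distribution_less:
  fixes M :: "'w measure" and F :: "'w \<Rightarrow> real^'n \<Rightarrow> real"
  assumes M: "prob_space M" and F: "centred_gaussian_field M F"
    and cont: "AE w in M. continuous_on UNIV (F w)"
    and \<rho>: "spectral_measure M F \<rho>" "rho4_star \<rho>"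
    and \<Psi>: "nodal_volume_distribution M F c \<Psi>"
    and st: "0 \<le> s" "s < t"
  shows "\<Psi> s < \<Psi> t"
proof -
  interpret prob_space M by (rule M)
  let ?n = "CARD('n)"
  define v where "v = unit_ball_vol (real ?n)"
  have v: "v > 0" by (simp add: v_def)
  have vol: "emeasure lborel (ball (0::real^'n) r) = ennreal (v * r ^ ?n)" if "r \<ge> 0" for r
    using that by (simp add: emeasure_ball v_def)
  \<comment> \<open>The inner volume is halfway between \<open>s\<close> and \<open>t\<close>, so
    strictly above \<open>s\<close> and positive even for \<open>s = 0\<close>; the outer volume is
    exactly \<open>t\<close>, which the non-strict bound in the count admits.\<close>
  define a where "a = root ?n ((s + t) / 2 / v)"
  define b where "b = root ?n (t / v)"
  have a: "a > 0" using st v by (simp add: a_def)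
  have "(s + t) / 2 / v < t / v" using st v by (intro divide_strict_right_mono) auto
  then have ab: "a < b" unfolding a_def b_def by (subst real_root_less_iff) auto
  have vol_a: "emeasure lborel (ball (0::real^'n) a) = ennreal ((s + t) / 2)"
    using a st v by (subst vol) (auto simp: a_def real_root_pow_pos2)
  have vol_b: "emeasure lborel (ball (0::real^'n) b) = ennreal t"
    using a ab st v by (subst vol) (auto simp: b_def real_root_pow_pos2)
  obtain q E where q: "q > 0" "\<And>z. E z \<in> sets M" "\<And>z. q \<le> prob (E z)"
    and E: "\<And>w z y. w \<in> E z \<Longrightarrow> continuous_on UNIV (F w) \<Longrightarrow> y \<in> cball z a \<Longrightarrow> F w y > 0"
      "\<And>w z y. w \<in> E z \<Longrightarrow> continuous_on UNIV (F w) \<Longrightarrow> y \<in> sphere z b \<Longrightarrow> F w y < 0"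
    by (rule sign_change_event[OF M F cont \<rho> a ab]) blast
  obtain k where k: "k > 0"
    and packing: "\<forall>\<^sub>F R in at_top. \<exists>X::(real^'n) set. finite X \<and> (\<forall>x\<in>X. ball x b \<subseteq> ball 0 R) \<and>
      (\<forall>x\<in>X. \<forall>y\<in>X. x \<noteq> y \<longrightarrow> ball x b \<inter> ball y b = {}) \<and> k * R ^ ?n \<le> real (card X)"
    using ball_packing[of b] a ab by auto
  \<comment> \<open>\<open>max\<close> covers \<open>c \<le> 0\<close>, where the normalisation \<open>ennreal c * vol\<close> is 0 and its inverse is \<open>\<infinity>\<close>.\<close>
  define \<delta> where "\<delta> = k * q / (max c 1 * v)"
  have \<delta>: "\<delta> > 0" using k q v by (simp add: \<delta>_def)
  let ?V = "\<lambda>R. ennreal c * emeasure lborel (ball (0::real^'n) R)"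
  have "ennreal (\<Psi> s) + ennreal \<delta> \<le> ennreal (\<Psi> t)"
  proof (rule tendsto_in_mean_gap)
    show "tendsto_in_mean M (\<lambda>R w. nodal_count (F w) (ennreal s) R / ?V R) (\<Psi> s)"
      "tendsto_in_mean M (\<lambda>R w. nodal_count (F w) (ennreal t) R / ?V R) (\<Psi> t)"
      using \<Psi> st by (auto simp: nodal_volume_distribution_def)
    show "\<forall>\<^sub>F R in at_top. \<exists>D\<in>borel_measurable M.
        (AE w in M. nodal_count (F w) (ennreal s) R / ?V R + D w \<le> nodal_count (F w) (ennreal t) R / ?V R) \<and>
        ennreal \<delta> \<le> (\<integral>\<^sup>+w. D w \<partial>M)"
      using packing eventually_gt_at_top[of 0]
    proof eventually_elim
      case (elim R)
      then obtain X :: "(real^'n) set" where "finite X" and inside: "\<forall>x\<in>X. ball x b \<subseteq> ball 0 R"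
        and disj: "\<forall>x\<in>X. \<forall>y\<in>X. x \<noteq> y \<longrightarrow> ball x b \<inter> ball y b = {}" and card: "k * R ^ ?n \<le> real (card X)"
        by (elim exE conjE)
      define G where "G w = {x \<in> X. w \<in> E x}" for w
      note [measurable] = q(2)
      \<comment> \<open>Up to normalisation, the number of centres at which the sign change occurs:
        a finite sum of indicators, hence measurable for \<open>M\<close> itself, with expectation
        at least \<open>q\<close> per centre.\<close>
      define D where "D w = (\<Sum>x\<in>X. indicator (E x) w) / ?V R" for w
      have "AE w in M. nodal_count (F w) (ennreal s) R / ?V R + D w \<le> nodal_count (F w) (ennreal t) R / ?V R"
        using cont
      proof eventually_elim
        case (elim w)
        have "nodal_count (F w) (ennreal s) R + of_nat (card (G w)) \<le> nodal_count (F w) (ennreal t) R"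
        proof (rule nodal_count_gap[OF elim a ab])
          show "finite (G w)" using \<open>finite X\<close> by (simp add: G_def)
          show "ennreal s \<le> ennreal t" using st by (intro ennreal_leI) simp
          show "ennreal s < emeasure lborel (ball (0::real^'n) a)"
            using st by (simp add: vol_a ennreal_less_iff)
          show "emeasure lborel (ball (0::real^'n) b) \<le> ennreal t" by (simp add: vol_b)
          show "ball x b \<subseteq> ball 0 R" if "x \<in> G w" for x using that inside by (simp add: G_def)
          show "ball x b \<inter> ball y b = {}" if "x \<in> G w" "y \<in> G w" "x \<noteq> y" for x y
            using that disj by (simp add: G_def)
          show "F w y > 0" if "x \<in> G w" "y \<in> cball x a" for x y
            using that elim by (intro E(1)[of w x]) (auto simp: G_def)
          show "F w y < 0" if "x \<in> G w" "y \<in> sphere x b" for x y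
            using that elim by (intro E(2)[of w x]) (auto simp: G_def)
        qed
        moreover have "(\<Sum>x\<in>X. indicator (E x) w :: ennreal) = of_nat (card (G w))"
        proof -
          have "(\<Sum>x\<in>X. indicator (E x) w :: ennreal) = (\<Sum>x\<in>G w. 1)"
            using \<open>finite X\<close> by (intro sum.mono_neutral_cong_right) (auto simp: indicator_def G_def)
          then show ?thesis by simp
        qed
        ultimately show ?case
          unfolding D_def add_divide_distrib_ennreal[symmetric]
          by (intro divide_right_mono_ennreal) simp
      qed
      moreover have "ennreal \<delta> \<le> (\<integral>\<^sup>+w. D w \<partial>M)"
      proof -
        have Rn: "R ^ ?n > 0" using elim by simp
        \<comment> \<open>The number of centres and the volume of the ball both scale like
          \<open>R ^ ?n\<close>; the factor cancels and the gap is independent of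
          \<open>R\<close>.\<close>
        have "\<delta> = k * R ^ ?n * q / (max c 1 * (v * R ^ ?n))"
          using elim(2) by (simp add: \<delta>_def)
        moreover have "ennreal (k * R ^ ?n * q / (max c 1 * (v * R ^ ?n))) \<le> ennreal (k * R ^ ?n * q) / ?V R"
        proof (cases "c > 0")
          case True
          have "?V R = ennreal (c * (v * R ^ ?n))"
            using True elim(2) v by (simp add: vol ennreal_mult)
          moreover have "k * R ^ ?n * q / (max c 1 * (v * R ^ ?n)) \<le> k * R ^ ?n * q / (c * (v * R ^ ?n))"
            using True k q v Rn by (intro divide_left_mono mult_right_mono) auto
          ultimately show ?thesis
            using True k q v Rn by (simp add: divide_ennreal ennreal_leI)
        next
          case False
          then show ?thesis
            using k q Rn by (simp add: ennreal_neg divide_ennreal_def ennreal_mult_top)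
        qed
        ultimately have "ennreal \<delta> \<le> ennreal (k * R ^ ?n * q) / ?V R" by simp
        also have "\<dots> \<le> ennreal (real (card X) * q) / ?V R"
          using card q by (intro divide_right_mono_ennreal ennreal_leI mult_right_mono) auto
        also have "ennreal (real (card X) * q) \<le> (\<Sum>x\<in>X. emeasure M (E x))"
        proof -
          have "real (card X) * q \<le> (\<Sum>x\<in>X. prob (E x))"
            using sum_mono[of X "\<lambda>_. q" "\<lambda>x. prob (E x)"] q(3) by simp
          then show ?thesis by (simp add: emeasure_eq_measure ennreal_leI)
        qed
        also have "(\<Sum>x\<in>X. emeasure M (E x)) / ?V R = (\<integral>\<^sup>+w. D w \<partial>M)"
          unfolding D_def by (simp add: nn_integral_divide nn_integral_sum)
        finally show ?thesis by (simp add: divide_right_mono_ennreal)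
      qed
      moreover have "D \<in> borel_measurable M" unfolding D_def by measurable
      ultimately show ?case by blast
    qed
  qed
  moreover have "\<Psi> s \<ge> 0"
    using \<Psi> st by (intro tendsto_in_mean_nonneg) (auto simp: nodal_volume_distribution_def)
  ultimately have "ennreal (\<Psi> s + \<delta>) \<le> ennreal (\<Psi> t)" using \<delta> by (simp add: ennreal_plus)
  then have "\<Psi> s + \<delta> \<le> \<Psi> t \<or> \<Psi> s + \<delta> \<le> 0" unfolding ennreal_le_iff2 by blast
  then show ?thesis using \<delta> \<open>\<Psi> s \<ge> 0\<close> by linarith
qed

text \<open>Nodal domains of a continuous function are open and nonempty, so almost surely the count
  at level 0 vanishes for every \<open>R\<close>. The mean distance to the limit is then the
  constant \<open>\<Psi> 0\<close>, which tends to 0 only if it is 0.\<close>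

lemma nodal_volume_distribution_0:
  fixes M :: "'w measure" and F :: "'w \<Rightarrow> real^'n \<Rightarrow> real"
  assumes M: "prob_space M" and cont: "AE w in M. continuous_on UNIV (F w)"
    and \<Psi>: "nodal_volume_distribution M F c \<Psi>"
  shows "\<Psi> 0 = 0"
proof -
  interpret prob_space M by (rule M)
  let ?X = "\<lambda>R w. nodal_count (F w) (ennreal 0) R / (ennreal c * emeasure lborel (ball (0 :: real^'n) R))"
  have lim: "tendsto_in_mean M ?X (\<Psi> 0)" using \<Psi> by (auto simp: nodal_volume_distribution_def)
  have nonneg: "\<Psi> 0 \<ge> 0" by (rule tendsto_in_mean_nonneg[OF lim])
  have "(\<integral>\<^sup>+w. e2ennreal \<bar>enn2ereal (?X R w) - ereal (\<Psi> 0)\<bar> \<partial>completion M) = ennreal (\<Psi> 0)" for R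
  proof -
    have "AE w in completion M. e2ennreal \<bar>enn2ereal (?X R w) - ereal (\<Psi> 0)\<bar> = ennreal (\<Psi> 0)"
      using AE_completion[OF cont]
      by eventually_elim (use nonneg in \<open>simp add: nodal_count_0 zero_ennreal.rep_eq e2ennreal_ereal\<close>)
    then have "(\<integral>\<^sup>+w. e2ennreal \<bar>enn2ereal (?X R w) - ereal (\<Psi> 0)\<bar> \<partial>completion M) =
        (\<integral>\<^sup>+w. ennreal (\<Psi> 0) \<partial>completion M)" by (rule nn_integral_cong_AE)
    then show ?thesis by (simp add: emeasure_completion_space)
  qed
  then have "((\<lambda>R::real. ennreal (\<Psi> 0)) \<longlongrightarrow> 0) at_top"
    using lim by (simp add: tendsto_in_mean_def)
  then have "ennreal (\<Psi> 0) = 0" by (simp add: tendsto_const_iff)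
  then show ?thesis using nonneg by simp
qed

theorem theorem3p2:
  fixes M :: "'w measure"
    and F :: "'w \<Rightarrow> real^'n \<Rightarrow> real"
    and \<rho> :: "(real^'n) measure"
    and c :: real
    and \<Psi> :: "real \<Rightarrow> real"
  assumes "prob_space M"
    and "centred_gaussian_field M F"
    and "AE w in M. C2_smooth (F w)"
    and "isotropic M F"
    and "\<forall>x. (LINT w|M. (F w x)^2) = 1"
    and "spectral_measure M F \<rho>"
    and "rho1 \<rho>" and "rho2 \<rho>" and "rho3 \<rho>" and "rho4_star \<rho>"
    and "nazarov_sodin_constant M F c"
    and "nodal_volume_distribution M F c \<Psi>"
  shows "\<Psi> 0 = 0 \<and> strict_mono_on {0..} \<Psi> \<and> (\<forall>t>0. \<Psi> t > 0)"
proof -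
  have cont: "AE w in M. continuous_on UNIV (F w)"
    using assms(3) by eventually_elim (rule C2_smooth_continuous)
  have less: "\<Psi> s < \<Psi> t" if "0 \<le> s" "s < t" for s t
    by (rule nodal_volume_distribution_less[OF assms(1,2) cont assms(6,10,12) that])
  have "\<Psi> 0 = 0" by (rule nodal_volume_distribution_0[OF assms(1) cont assms(12)])
  with less[of 0] less show ?thesis by (auto simp: strict_mono_on_def)
qed

end
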